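(* Let $K$ be a commutative $\mathbb Q$-algebra, let $P\in K[X]=K[X_1,\ldots,X_n]$, and let $r,e$ be positive integers. (1) If $P$ is homogeneous of degree $\ge 2$ with $(\mathrm{Hess}\,P)^r=0$, then $\rho_P(\mathcal C(r))=0$. (2) If $\deg P\le e$, then $\rho_P(\mathcal V(e))=0$. Thus if $P$ is homogeneous of degree $\ge2$ and $\le e$ with $(\mathrm{Hess}\,P)^r=0$, then $\rho_P$ induces a homomorphism $\overline\rho_P(r,e):\overline{\mathcal M}(r,e)\to K[X]$ such that the diagram $$\begin{matrix}\mathcal H\times\overline{\mathcal M}(r,e)&\to&\overline{\mathcal M}(r,e)\\ \downarrow&&\downarrow\\ \mathfrak D[X]\times K[X]&\to&K[X]\end{matrix}$$ commutes, where the horizontal arrows are the module structures and the vertical arrows are $\varphi_P\times\overline\rho_P(r,e)$ and $\overline\rho_P(r,e)$. The last statement also holds for $e=\infty$ (i.e. with $\overline{\mathcal M}(r,\infty)$ and no upper bound on the degree of $P$).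
   Context: All trees are finite. $D_i=\partial/\partial X_i$, $\mathrm{Hess}\,P=(D_iD_jP)$. $\mathbb T_{\rm rt}$ is the set of isomorphism classes of rooted trees, $\mathbb T$ the set of isomorphism classes of free (unrooted) trees, $\mathbb T_m\subset\mathbb T$ those with $m$ vertices. $V(T)$, $E(T)$ are the vertex and edge sets of $T$. Grossman–Larson algebra: $\mathcal H$ is the $\mathbb Q$-vector space with basis $\mathbb T_{\rm rt}$. For a tree $T$ (rooted or not), rooted trees $S_1,\ldots,S_k$ and $v_1,\ldots,v_k\in V(T)$, let $(S_1,\ldots,S_k)\multimap_{(v_1,\ldots,v_k)}T$ be the tree obtained by joining, for each $i$, the root of $S_i$ to $v_i$ by a new edge (if $T$ is rooted, the root is that of $T$; otherwise the result is unrooted). For a rooted tree $S$, let $S_1,\ldots,S_k$ (with multiplicity) be the rooted trees obtained by deleting the root of $S$ and its adjacent edges, rooted at the children of the root of $S$. Define $$S\cdot T=\sum_{(v_1,\ldots,v_k)\in V(T)^k}(S_1,\ldots,S_k)\multimap_{(v_1,\ldots,v_k)}T .$$ Extended linearly, for rooted $T$ this makes $\mathcal H$ an associative unital $\mathbb Q$-algebra, and for unrooted $T$ it makes the $\mathbb Q$-vector space $\mathcal M$ with basis $\mathbb T$ into an $\mathcal H$-module. A naked $r$-chain in a tree is a geodesic with vertices $v_1,\ldots,v_r$ (consecutive ones joined by edges) such that $v_2,\ldots,v_{r-1}$ have degree $2$ in the tree and $v_1,v_r$ have degree $1$ or $2$. $\mathcal C(r)$ is the $\mathcal H$-submodule of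 $\mathcal M$ generated by all trees containing a naked $r$-chain. $\mathcal V(e)$ is the $\mathbb Q$-subspace (in fact $\mathcal H$-submodule) spanned by all trees having at least one vertex of degree $\ge e+1$. Put $\overline{\mathcal M}(r,e)=\mathcal M/(\mathcal C(r)+\mathcal V(e))$ and $\overline{\mathcal M}(r,\infty)=\mathcal M/\mathcal C(r)$. $\mathfrak D[X]$ is the ring of differential operators on $K[X]$. For a labeling $\ell:E(T)\to\{1,\ldots,n\}$ of the edges of a tree and $v\in V(T)$ with adjacent edges $e_1,\ldots,e_s$, put $D_{\mathrm{adj}(v)}=D_{\ell(e_1)}\cdots D_{\ell(e_s)}$. The map $\rho_P:\mathcal M\to K[X]$ is the $\mathbb Q$-linear map sending an unrooted tree $T$ to $$\mathcal Q_{T,P}=\sum_{\ell:E(T)\to\{1,\ldots,n\}}\ \prod_{v\in V(T)}D_{\mathrm{adj}(v)}P .$$ The map $\varphi_P:\mathcal H\to\mathfrak D[X]$ is the ($\mathbb Q$-linear) ring homomorphism sending a rooted tree $S$ with root $\mathrm{rt}_S$, whose adjacent edges are $e_1,\ldots,e_k$, to $$\sum_{\ell:E(S)\to\{1,\ldots,n\}}\Big(\prod_{v\in V(S)\setminus\{\mathrm{rt}_S\}}D_{\mathrm{adj}(v)}P\Big)D_{\ell(e_1)}\cdots D_{\ell(e_k)} .$$ *)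

theory Defs
  imports
    "HOL-Analysis.Cartesian_Space"
    "HOL-Library.Poly_Mapping"
    "HOL-Library.Set_Algebras"
    "HOL-Library.FuncSet"
    "HOL-Library.Extended_Nat"
begin

section \<open>Rational vector spaces and commutative rational algebras\<close>

class scaleQ =
  fixes scaleQ :: "rat \<Rightarrow> 'a \<Rightarrow> 'a" (infixr \<open>*\<^sub>Q\<close> 75)

class rat_vector = scaleQ + ab_group_add +
  assumes scaleQ_add_right: "a *\<^sub>Q (x + y) = a *\<^sub>Q x + a *\<^sub>Q y"
    and scaleQ_add_left: "(a + b) *\<^sub>Q x = a *\<^sub>Q x + b *\<^sub>Q x"
    and scaleQ_scaleQ: "a *\<^sub>Q (b *\<^sub>Q x) = (a * b) *\<^sub>Q x"
    and scaleQ_one: "1 *\<^sub>Q x = x"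

class comm_rat_algebra = rat_vector + comm_ring_1 +
  assumes mult_scaleQ_left: "(a *\<^sub>Q x) * y = a *\<^sub>Q (x * y)"

global_interpretation rat_vec: vector_space "scaleQ :: rat \<Rightarrow> 'a \<Rightarrow> 'a::rat_vector"
  by unfold_locales (rule scaleQ_add_right scaleQ_add_left scaleQ_scaleQ scaleQ_one)+

instantiation rat :: comm_rat_algebra
begin
definition scaleQ_rat :: "rat \<Rightarrow> rat \<Rightarrow> rat" where "scaleQ_rat = (*)"
instance by standard (auto simp: scaleQ_rat_def algebra_simps)
end

instantiation poly_mapping :: (type, rat_vector) rat_vector
begin
definition scaleQ_poly_mapping :: "rat \<Rightarrow> ('a \<Rightarrow>\<^sub>0 'b) \<Rightarrow> ('a \<Rightarrow>\<^sub>0 'b)" where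
  "c *\<^sub>Q p = Poly_Mapping.map (scaleQ c) p"

lemma lookup_scaleQ [simp]:
  "Poly_Mapping.lookup (c *\<^sub>Q p) k = c *\<^sub>Q Poly_Mapping.lookup p k"
  unfolding scaleQ_poly_mapping_def by transfer (simp add: when_def)

instance
  by standard (auto intro!: poly_mapping_eqI
      simp: lookup_add scaleQ_add_right scaleQ_add_left scaleQ_scaleQ scaleQ_one)
end

instance poly_mapping :: (comm_monoid_add, comm_rat_algebra) comm_rat_algebra
proof
  fix c :: rat and p q :: "'a \<Rightarrow>\<^sub>0 'b"
  have *: "c *\<^sub>Q r = Poly_Mapping.single 0 (c *\<^sub>Q 1) * r" for r :: "'a \<Rightarrow>\<^sub>0 'b"
  proof -
    have eq: "scaleQ c = (*) (c *\<^sub>Q (1::'b))"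
      by (simp add: fun_eq_iff mult_scaleQ_left)
    have "c *\<^sub>Q r = Poly_Mapping.map ((*) (c *\<^sub>Q (1::'b))) r"
      unfolding scaleQ_poly_mapping_def by (rule arg_cong[OF eq])
    then show ?thesis
      by (simp only: mult_map_scale_conv_mult)
  qed
  show "(c *\<^sub>Q p) * q = c *\<^sub>Q (p * q)"
    by (simp add: * mult.assoc)
qed

abbreviation basis :: "'b \<Rightarrow> ('b \<Rightarrow>\<^sub>0 rat)" where
  "basis b \<equiv> Poly_Mapping.single b 1"

definition lin_ext :: "('b \<Rightarrow> 'c::rat_vector) \<Rightarrow> ('b \<Rightarrow>\<^sub>0 rat) \<Rightarrow> 'c" where
  "lin_ext f m = (\<Sum>b\<in>Poly_Mapping.keys m. Poly_Mapping.lookup m b *\<^sub>Q f b)"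

lemma lin_ext_superset:
  assumes "finite B" "Poly_Mapping.keys m \<subseteq> B"
  shows "lin_ext f m = (\<Sum>b\<in>B. Poly_Mapping.lookup m b *\<^sub>Q f b)"
  unfolding lin_ext_def
  by (rule sum.mono_neutral_left) (use assms in \<open>auto simp: in_keys_iff\<close>)

lemma lin_ext_basis [simp]: "lin_ext f (basis b) = f b"
  by (simp add: lin_ext_def)

lemma lin_ext_add: "lin_ext f (m + m') = lin_ext f m + lin_ext f m'"
proof -
  let ?B = "Poly_Mapping.keys m \<union> Poly_Mapping.keys m'"
  have "Poly_Mapping.keys (m + m') \<subseteq> ?B" by (rule keys_add)
  then show ?thesis
    by (simp add: lin_ext_superset[of ?B] lookup_add rat_vec.scale_left_distrib sum.distrib)
qed

lemma lin_ext_scale: "lin_ext f (c *\<^sub>Q m) = c *\<^sub>Q lin_ext f m"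
proof -
  have "Poly_Mapping.keys (c *\<^sub>Q m) \<subseteq> Poly_Mapping.keys m"
    by (auto simp: in_keys_iff)
  then show ?thesis
    by (simp add: lin_ext_superset[of "Poly_Mapping.keys m"] scaleQ_rat_def rat_vec.scale_sum_right)
qed


section \<open>Polynomials and differential operators\<close>

text \<open>
  \<open>('n, 'a) mpoly\<close> is the polynomial ring over \<open>'a\<close> with one variable for each element of the
  finite index type \<open>'n\<close>; a monomial is its exponent vector.
\<close>

type_synonym ('n, 'a) mpoly = "('n \<Rightarrow>\<^sub>0 nat) \<Rightarrow>\<^sub>0 'a"

definition monom_degree :: "('n::finite \<Rightarrow>\<^sub>0 nat) \<Rightarrow> nat" where
  "monom_degree m = (\<Sum>i\<in>UNIV. Poly_Mapping.lookup m i)"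

definition homogeneous :: "nat \<Rightarrow> ('n::finite, 'a::zero) mpoly \<Rightarrow> bool" where
  "homogeneous d p \<longleftrightarrow> (\<forall>m\<in>Poly_Mapping.keys p. monom_degree m = d)"

text \<open>By convention the zero polynomial gets total degree \<open>0\<close>.\<close>

definition total_degree :: "('n::finite, 'a::zero) mpoly \<Rightarrow> nat" where
  "total_degree p = Max (insert 0 (monom_degree ` Poly_Mapping.keys p))"

text \<open>The linear extension of \<open>X\<^sup>m \<mapsto> m\<^sub>i X\<^bsup>m - i\<^esup>\<close>. The truncated subtraction of exponents
  is harmless, since the coefficient vanishes if \<open>m\<^sub>i = 0\<close>.\<close>

definition partial :: "'n \<Rightarrow> ('n, 'a::comm_ring_1) mpoly \<Rightarrow> ('n, 'a) mpoly" where
  "partial i p = (\<Sum>m\<in>Poly_Mapping.keys p.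
     Poly_Mapping.single (m - Poly_Mapping.single i 1)
       (of_nat (Poly_Mapping.lookup m i) * Poly_Mapping.lookup p m))"

lemma minus_single_eq_iff:
  fixes m k :: "'n \<Rightarrow>\<^sub>0 nat"
  assumes "Poly_Mapping.lookup m i \<noteq> 0"
  shows "m - Poly_Mapping.single i 1 = k \<longleftrightarrow> m = k + Poly_Mapping.single i 1"
proof
  assume *: "m - Poly_Mapping.single i 1 = k"
  show "m = k + Poly_Mapping.single i 1"
    using assms
    by (intro poly_mapping_eqI)
       (auto simp: *[symmetric] lookup_add lookup_minus lookup_single when_def)
qed simp

lemma lookup_partial:
  "Poly_Mapping.lookup (partial i p) k =
     of_nat (Poly_Mapping.lookup k i + 1) * Poly_Mapping.lookup p (k + Poly_Mapping.single i 1)"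
proof -
  let ?k = "k + Poly_Mapping.single i 1"
  have "Poly_Mapping.lookup (partial i p) k =
      (\<Sum>m\<in>Poly_Mapping.keys p. if m = ?k
         then of_nat (Poly_Mapping.lookup m i) * Poly_Mapping.lookup p m else 0)"
    unfolding partial_def lookup_sum
  proof (rule sum.cong)
    fix m assume "m \<in> Poly_Mapping.keys p"
    show "Poly_Mapping.lookup (Poly_Mapping.single (m - Poly_Mapping.single i 1)
            (of_nat (Poly_Mapping.lookup m i) * Poly_Mapping.lookup p m)) k =
          (if m = ?k then of_nat (Poly_Mapping.lookup m i) * Poly_Mapping.lookup p m else 0)"
    proof (cases "Poly_Mapping.lookup m i = 0")
      case True
      then have "m \<noteq> ?k" by (auto simp: lookup_add)
      with True show ?thesis by simp
    next
      case False
      then show ?thesis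
        by (simp only: lookup_single when_def minus_single_eq_iff[OF False])
    qed
  qed simp
  also have "\<dots> = of_nat (Poly_Mapping.lookup ?k i) * Poly_Mapping.lookup p ?k"
    by (auto simp: sum.delta in_keys_iff)
  finally show ?thesis by (simp add: lookup_add)
qed

lemma partial_commute: "partial i (partial j p) = partial j (partial i p)"
proof (cases "i = j")
  case False
  then show ?thesis
    by (intro poly_mapping_eqI)
       (simp add: lookup_partial lookup_add lookup_single ac_simps)
qed simp

definition Hess :: "('n::finite, 'a::comm_ring_1) mpoly \<Rightarrow> ('n, 'a) mpoly ^ 'n ^ 'n" where
  "Hess p = (\<chi> i j. partial i (partial j p))"

text \<open>The \<open>r\<close>-th power for the matrix product (the library's \<open>^\<close> on \<open>vec\<close> is componentwise).\<close>

definition matrix_pow :: "'a::semiring_1 ^ 'n ^ 'n \<Rightarrow> nat \<Rightarrow> 'a ^ 'n ^ 'n" where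
  "matrix_pow A r = (((**) A) ^^ r) (mat 1)"

text \<open>
  The ring of differential operators, as the subring of the endomorphisms of the polynomial ring
  (with composition as product) generated by the multiplications and the partial derivatives.
\<close>

inductive_set diff_ops :: "(('n, 'a::comm_ring_1) mpoly \<Rightarrow> ('n, 'a) mpoly) set" where
  mult: "(\<lambda>f. g * f) \<in> diff_ops"
| partial: "partial i \<in> diff_ops"
| add: "A \<in> diff_ops \<Longrightarrow> B \<in> diff_ops \<Longrightarrow> (\<lambda>f. A f + B f) \<in> diff_ops"
| comp: "A \<in> diff_ops \<Longrightarrow> B \<in> diff_ops \<Longrightarrow> A \<circ> B \<in> diff_ops"


section \<open>Trees\<close>

type_synonym 'v graph = "'v set \<times> 'v set set"

abbreviation verts :: "'v graph \<Rightarrow> 'v set" where "verts G \<equiv> fst G"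
abbreviation edges :: "'v graph \<Rightarrow> 'v set set" where "edges G \<equiv> snd G"

definition adj_edges :: "'v graph \<Rightarrow> 'v \<Rightarrow> 'v set set" where
  "adj_edges G v = {e \<in> edges G. v \<in> e}"

definition vdegree :: "'v graph \<Rightarrow> 'v \<Rightarrow> nat" where
  "vdegree G v = card (adj_edges G v)"

definition walk :: "'v graph \<Rightarrow> 'v list \<Rightarrow> bool" where
  "walk G vs \<longleftrightarrow> vs \<noteq> [] \<and> set vs \<subseteq> verts G \<and> successively (\<lambda>u v. {u, v} \<in> edges G) vs"

definition cycle :: "'v graph \<Rightarrow> 'v list \<Rightarrow> bool" where
  "cycle G vs \<longleftrightarrow> walk G vs \<and> distinct vs \<and> 3 \<le> length vs \<and> {last vs, hd vs} \<in> edges G"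

definition geodesic :: "'v graph \<Rightarrow> 'v list \<Rightarrow> bool" where
  "geodesic G vs \<longleftrightarrow> walk G vs \<and>
     (\<forall>ws. walk G ws \<and> hd ws = hd vs \<and> last ws = last vs \<longrightarrow> length vs \<le> length ws)"

definition is_tree :: "'v graph \<Rightarrow> bool" where
  "is_tree G \<longleftrightarrow>
     finite (verts G) \<and> verts G \<noteq> {} \<and>
     edges G \<subseteq> {{u, v} | u v. u \<in> verts G \<and> v \<in> verts G \<and> u \<noteq> v} \<and>
     (\<forall>u\<in>verts G. \<forall>v\<in>verts G. \<exists>vs. walk G vs \<and> hd vs = u \<and> last vs = v) \<and>
     (\<nexists>vs. cycle G vs)"

definition is_rooted_tree :: "'v graph \<times> 'v \<Rightarrow> bool" where
  "is_rooted_tree S \<longleftrightarrow> is_tree (fst S) \<and> snd S \<in> verts (fst S)"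

definition is_iso :: "('v \<Rightarrow> 'w) \<Rightarrow> 'v graph \<Rightarrow> 'w graph \<Rightarrow> bool" where
  "is_iso f G H \<longleftrightarrow> bij_betw f (verts G) (verts H) \<and> (`) f ` edges G = edges H"

definition tree_iso :: "'v graph \<Rightarrow> 'w graph \<Rightarrow> bool" where
  "tree_iso G H \<longleftrightarrow> (\<exists>f. is_iso f G H)"

definition rooted_tree_iso :: "'v graph \<times> 'v \<Rightarrow> 'w graph \<times> 'w \<Rightarrow> bool" where
  "rooted_tree_iso S T \<longleftrightarrow> (\<exists>f. is_iso f (fst S) (fst T) \<and> f (snd S) = snd T)"

lemma tree_edges_subset: "is_tree G \<Longrightarrow> e \<in> edges G \<Longrightarrow> e \<subseteq> verts G"
  by (fastforce simp: is_tree_def)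

lemma finite_edges: "is_tree G \<Longrightarrow> finite (edges G)"
  by (rule finite_subset[of _ "Pow (verts G)"]) (auto simp: is_tree_def dest: tree_edges_subset)

lemma is_iso_id: "is_iso id G G"
  by (simp add: is_iso_def image_def)

lemma is_iso_comp:
  assumes "is_iso f G H" "is_iso g H K"
  shows "is_iso (g \<circ> f) G K"
proof -
  have "(`) (g \<circ> f) ` edges G = (`) g ` ((`) f ` edges G)"
    by (simp add: image_image image_comp)
  with assms show ?thesis
    by (auto simp: is_iso_def intro: bij_betw_trans)
qed

lemma is_iso_inv:
  assumes "\<Union>(edges G) \<subseteq> verts G" "is_iso f G H"
  shows "is_iso (inv_into (verts G) f) H G"
proof -
  let ?g = "inv_into (verts G) f"
  have bij: "bij_betw f (verts G) (verts H)" and E: "edges H = (`) f ` edges G"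
    using assms(2) by (auto simp: is_iso_def)
  have "?g ` (f ` e) = e" if "e \<in> edges G" for e
    by (rule inv_into_image_cancel) (use that assms(1) bij in \<open>auto simp: bij_betw_def\<close>)
  then have "(`) ?g ` edges H = edges G"
    unfolding E by (force simp: image_image)
  with bij_betw_inv_into[OF bij] show ?thesis
    by (simp add: is_iso_def)
qed

lemma tree_iso_sym: "is_tree G \<Longrightarrow> tree_iso G H \<Longrightarrow> tree_iso H G"
  unfolding tree_iso_def using is_iso_inv tree_edges_subset by (metis Union_least)

lemma tree_iso_trans: "tree_iso G H \<Longrightarrow> tree_iso H K \<Longrightarrow> tree_iso G K"
  unfolding tree_iso_def using is_iso_comp by blast

lemma rooted_tree_iso_sym:
  assumes "is_rooted_tree S" "rooted_tree_iso S T"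
  shows "rooted_tree_iso T S"
proof -
  obtain f where f: "is_iso f (fst S) (fst T)" "f (snd S) = snd T"
    using assms(2) by (auto simp: rooted_tree_iso_def)
  have "is_iso (inv_into (verts (fst S)) f) (fst T) (fst S)"
    using assms(1) f(1) by (intro is_iso_inv) (auto simp: is_rooted_tree_def dest: tree_edges_subset)
  moreover have "inv_into (verts (fst S)) f (snd T) = snd S"
    using assms(1) f inv_into_f_f[of f "verts (fst S)" "snd S"]
    by (simp add: is_iso_def bij_betw_def is_rooted_tree_def)
  ultimately show ?thesis
    unfolding rooted_tree_iso_def by blast
qed

lemma rooted_tree_iso_trans:
  assumes "rooted_tree_iso S T" "rooted_tree_iso T U"
  shows "rooted_tree_iso S U"
proof -
  obtain f g where "is_iso f (fst S) (fst T)" "f (snd S) = snd T"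
    "is_iso g (fst T) (fst U)" "g (snd T) = snd U"
    using assms by (auto simp: rooted_tree_iso_def)
  then have "is_iso (g \<circ> f) (fst S) (fst U)" "(g \<circ> f) (snd S) = snd U"
    by (auto intro: is_iso_comp)
  then show ?thesis
    unfolding rooted_tree_iso_def by blast
qed

lemma walk_map:
  assumes "is_iso f G H" "walk G vs"
  shows "walk H (map f vs)"
proof -
  have "successively (\<lambda>u v. {f u, f v} \<in> edges H) vs"
  proof (rule successively_mono[where P = "\<lambda>u v. {u, v} \<in> edges G"])
    show "successively (\<lambda>u v. {u, v} \<in> edges G) vs"
      using assms(2) by (simp add: walk_def)
    fix u v assume "{u, v} \<in> edges G"
    then have "f ` {u, v} \<in> (`) f ` edges G" by (rule imageI)
    then show "{f u, f v} \<in> edges H"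
      using assms(1) by (simp add: is_iso_def)
  qed
  moreover have "f ` verts G = verts H"
    using assms(1) by (simp add: is_iso_def bij_betw_def)
  then have "set (map f vs) \<subseteq> verts H" "map f vs \<noteq> []"
    using assms(2) unfolding walk_def by auto
  ultimately show ?thesis
    by (simp add: walk_def successively_map)
qed

lemma is_treeD:
  assumes "is_tree G"
  shows "finite (verts G)" "verts G \<noteq> {}"
    "e \<in> edges G \<Longrightarrow> \<exists>u v. e = {u, v} \<and> u \<in> verts G \<and> v \<in> verts G \<and> u \<noteq> v"
    "u \<in> verts G \<Longrightarrow> v \<in> verts G \<Longrightarrow> \<exists>vs. walk G vs \<and> hd vs = u \<and> last vs = v"
    "\<not> cycle G vs"
  using assms by (auto simp: is_tree_def)

lemma is_treeI:
  assumes "finite (verts G)" "verts G \<noteq> {}"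
    "\<And>e. e \<in> edges G \<Longrightarrow> \<exists>u v. e = {u, v} \<and> u \<in> verts G \<and> v \<in> verts G \<and> u \<noteq> v"
    "\<And>u v. u \<in> verts G \<Longrightarrow> v \<in> verts G \<Longrightarrow> \<exists>vs. walk G vs \<and> hd vs = u \<and> last vs = v"
    "\<And>vs. \<not> cycle G vs"
  shows "is_tree G"
  unfolding is_tree_def
proof (intro conjI ballI subsetI)
  show "\<nexists>vs. cycle G vs" using assms(5) by simp
qed (use assms(1-4) in simp_all)

lemma is_tree_iso:
  assumes G: "is_tree G" and f: "is_iso f G H"
  shows "is_tree H"
proof (rule is_treeI)
  define g where "g = inv_into (verts G) f"
  have g: "is_iso g H G"
    unfolding g_def using G f by (intro is_iso_inv) (auto dest: tree_edges_subset)
  have V: "verts H = f ` verts G" and inj: "inj_on f (verts G)" and E: "edges H = (`) f ` edges G"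
    using f by (auto simp: is_iso_def bij_betw_def)
  show "finite (verts H)" "verts H \<noteq> {}"
    unfolding V using is_treeD(1,2)[OF G] by simp_all
  show "\<exists>u v. e = {u, v} \<and> u \<in> verts H \<and> v \<in> verts H \<and> u \<noteq> v" if e: "e \<in> edges H" for e
  proof -
    obtain e' where e': "e' \<in> edges G" "e = f ` e'" using e unfolding E by auto
    obtain u v where uv: "e' = {u, v}" "u \<in> verts G" "v \<in> verts G" "u \<noteq> v"
      using is_treeD(3)[OF G e'(1)] by metis
    have "f u \<noteq> f v" using inj_onD[OF inj _ uv(2,3)] uv(4) by metis
    then show ?thesis
      using uv e'(2) unfolding V by (intro exI[of _ "f u"] exI[of _ "f v"]) simp
  qed
  show "\<exists>vs. walk H vs \<and> hd vs = u \<and> last vs = v" if H: "u \<in> verts H" "v \<in> verts H" for u v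
  proof -
    obtain u' where u: "u' \<in> verts G" "u = f u'" using H(1) unfolding V by (rule imageE)
    obtain v' where v: "v' \<in> verts G" "v = f v'" using H(2) unfolding V by (rule imageE)
    obtain vs where vs: "walk G vs" "hd vs = u'" "last vs = v'"
      using is_treeD(4)[OF G u(1) v(1)] by metis
    then have "vs \<noteq> []" by (simp add: walk_def)
    with vs u v show ?thesis
      by (intro exI[of _ "map f vs"]) (simp add: walk_map[OF f] hd_map last_map)
  qed
  show "\<not> cycle H vs" for vs
  proof
    assume c: "cycle H vs"
    have vs: "walk H vs" "vs \<noteq> []" "set vs \<subseteq> verts H"
      using c by (simp_all add: cycle_def walk_def)
    have inj_g: "inj_on g (verts H)" using g by (simp add: is_iso_def bij_betw_def)
    have "distinct (map g vs)"
      using c inj_on_subset[OF inj_g vs(3)] by (simp add: distinct_map cycle_def)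
    moreover have "{last (map g vs), hd (map g vs)} \<in> edges G"
    proof -
      have "{last vs, hd vs} \<in> edges H" using c by (simp add: cycle_def)
      then have "g ` {last vs, hd vs} \<in> (`) g ` edges H" by (rule imageI)
      with g vs(2) show ?thesis by (simp add: is_iso_def hd_map last_map)
    qed
    ultimately have "cycle G (map g vs)"
      using c walk_map[OF g vs(1)] by (simp add: cycle_def)
    then show False using is_treeD(5)[OF G] by simp
  qed
qed

lemma is_tree_single: "is_tree ({v}, {})"
proof (rule is_treeI)
  show "\<exists>vs. walk ({v}, {}) vs \<and> hd vs = x \<and> last vs = y"
    if "x \<in> verts ({v}, {})" "y \<in> verts ({v}, {})" for x y
    using that by (intro exI[of _ "[v]"]) (simp add: walk_def)
qed (simp_all add: cycle_def)

quotient_type utree = "nat graph" / partial: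
  "\<lambda>G H. is_tree G \<and> is_tree H \<and> tree_iso G H"
proof (rule part_equivpI)
  show "\<exists>G :: nat graph. is_tree G \<and> is_tree G \<and> tree_iso G G"
    using is_tree_single is_iso_id unfolding tree_iso_def by metis
  show "symp (\<lambda>G H :: nat graph. is_tree G \<and> is_tree H \<and> tree_iso G H)"
    by (rule sympI) (metis tree_iso_sym)
  show "transp (\<lambda>G H :: nat graph. is_tree G \<and> is_tree H \<and> tree_iso G H)"
    by (rule transpI) (metis tree_iso_trans)
qed

quotient_type rtree = "nat graph \<times> nat" / partial:
  "\<lambda>S T. is_rooted_tree S \<and> is_rooted_tree T \<and> rooted_tree_iso S T"
proof (rule part_equivpI)
  let ?S = "(({0 :: nat}, {}), 0 :: nat)"
  have "is_rooted_tree ?S"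
    by (simp add: is_rooted_tree_def is_tree_single)
  moreover have "rooted_tree_iso ?S ?S"
    unfolding rooted_tree_iso_def by (rule exI[of _ id]) (simp add: is_iso_id)
  ultimately show "\<exists>S :: nat graph \<times> nat. is_rooted_tree S \<and> is_rooted_tree S \<and> rooted_tree_iso S S"
    by (intro exI[of _ ?S]) simp
  show "symp (\<lambda>S T :: nat graph \<times> nat. is_rooted_tree S \<and> is_rooted_tree T \<and> rooted_tree_iso S T)"
    by (rule sympI) (metis rooted_tree_iso_sym)
  show "transp (\<lambda>S T :: nat graph \<times> nat. is_rooted_tree S \<and> is_rooted_tree T \<and> rooted_tree_iso S T)"
    by (rule transpI) (metis rooted_tree_iso_trans)
qed

text \<open>
  \<^const>\<open>rep_utree\<close> and \<^const>\<open>rep_rtree\<close> choose a representative of an isomorphism class, and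
  \<open>utree_of\<close> is the isomorphism class of a tree with vertices of any type.
\<close>

definition utree_of :: "'v graph \<Rightarrow> utree" where
  "utree_of G = (THE T. tree_iso (rep_utree T) G)"

lemma is_tree_rep_utree: "is_tree (rep_utree T)"
  using Quotient_rep_reflp[OF Quotient_utree, of T] by (rule conjunct1)

lemma is_rooted_tree_rep_rtree: "is_rooted_tree (rep_rtree S)"
  using Quotient_rep_reflp[OF Quotient_rtree, of S] by (rule conjunct1)

lemma utree_eqI: "tree_iso (rep_utree T) (rep_utree U) \<Longrightarrow> T = U"
  using Quotient_rel_rep[OF Quotient_utree, of T U] is_tree_rep_utree by simp

lemma utree_of_eq_iff:
  assumes G: "is_tree G"
  shows "utree_of G = T \<longleftrightarrow> tree_iso (rep_utree T) G"
proof -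
  have "finite (verts G)" using G by (rule is_treeD(1))
  then obtain f :: "'a \<Rightarrow> nat" where inj: "inj_on f (verts G)"
    using finite_imp_inj_to_nat_seg by metis
  define H where "H = (f ` verts G, (`) f ` edges G)"
  have iso: "is_iso f G H"
    using inj by (simp add: is_iso_def H_def bij_betw_def)
  then have H: "is_tree H" by (rule is_tree_iso[OF G])
  have "tree_iso H H"
    unfolding tree_iso_def by (rule exI) (rule is_iso_id)
  then have "tree_iso (rep_utree (abs_utree H)) H"
    using Quotient_rep_abs[OF Quotient_utree, of H] H by simp
  moreover have "tree_iso H G"
    by (rule tree_iso_sym[OF G]) (unfold tree_iso_def, rule exI, rule iso)
  ultimately have ex: "tree_iso (rep_utree (abs_utree H)) G"
    by (rule tree_iso_trans)
  have uniq: "T = U" if T: "tree_iso (rep_utree T) G" and U: "tree_iso (rep_utree U) G" for T U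
    by (rule utree_eqI) (rule tree_iso_trans[OF T tree_iso_sym[OF is_tree_rep_utree U]])
  have "utree_of G = abs_utree H"
    unfolding utree_of_def by (rule the_equality) (use ex uniq in simp_all)
  with ex uniq[of T "abs_utree H"] show ?thesis by auto
qed

lemma utree_of_rep [simp]: "utree_of (rep_utree T) = T"
  unfolding utree_of_eq_iff[OF is_tree_rep_utree] tree_iso_def by (rule exI) (rule is_iso_id)


section \<open>The Grossman--Larson action and its submodules\<close>

type_synonym HH = "rtree \<Rightarrow>\<^sub>0 rat"
type_synonym MM = "utree \<Rightarrow>\<^sub>0 rat"

definition children :: "'v graph \<times> 'v \<Rightarrow> 'v set" where
  "children S = {c \<in> verts (fst S). {snd S, c} \<in> edges (fst S)}"

text \<open>
  Deleting the root of \<open>S\<close> leaves the disjoint union of \<open>S\<^sub>1, \<dots>, S\<^sub>k\<close>, which are indexed by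
  their roots, the children of the root of \<open>S\<close>. So a tuple \<open>(v\<^sub>1, \<dots>, v\<^sub>k)\<close> is a function \<open>\<nu>\<close> on
  the children, and \<open>graft S \<nu> T\<close> joins each child \<open>c\<close> to the vertex \<open>\<nu> c\<close> of \<open>T\<close>.
\<close>

definition graft :: "'v graph \<times> 'v \<Rightarrow> ('v \<Rightarrow> 'w) \<Rightarrow> 'w graph \<Rightarrow> ('v + 'w) graph" where
  "graft S \<nu> T =
    (Inl ` (verts (fst S) - {snd S}) \<union> Inr ` verts T,
     (`) Inl ` {e \<in> edges (fst S). snd S \<notin> e} \<union> (`) Inr ` edges T \<union>
       {{Inl c, Inr (\<nu> c)} | c. c \<in> children S})"

definition gl_tree :: "rtree \<Rightarrow> utree \<Rightarrow> MM" where
  "gl_tree S T =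
     (\<Sum>\<nu> \<in> children (rep_rtree S) \<rightarrow>\<^sub>E verts (rep_utree T).
        basis (utree_of (graft (rep_rtree S) \<nu> (rep_utree T))))"

definition gl_act :: "HH \<Rightarrow> MM \<Rightarrow> MM" (infixr \<open>\<odot>\<close> 70) where
  "h \<odot> m = lin_ext (\<lambda>S. lin_ext (gl_tree S) m) h"

definition gl_submodule :: "MM set \<Rightarrow> bool" where
  "gl_submodule N \<longleftrightarrow> rat_vec.subspace N \<and> (\<forall>h. \<forall>m\<in>N. h \<odot> m \<in> N)"

definition naked_chain :: "nat \<Rightarrow> 'v graph \<Rightarrow> 'v list \<Rightarrow> bool" where
  "naked_chain r G vs \<longleftrightarrow> geodesic G vs \<and> length vs = r \<and>
     (\<forall>i. 0 < i \<and> i < r - 1 \<longrightarrow> vdegree G (vs ! i) = 2) \<and>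
     vdegree G (hd vs) \<in> {1, 2} \<and> vdegree G (last vs) \<in> {1, 2}"

definition CC :: "nat \<Rightarrow> MM set" where
  "CC r = gl_submodule hull {basis T | T. \<exists>vs. naked_chain r (rep_utree T) vs}"

definition VV :: "nat \<Rightarrow> MM set" where
  "VV e = rat_vec.span {basis T | T. \<exists>v\<in>verts (rep_utree T). e + 1 \<le> vdegree (rep_utree T) v}"

text \<open>The submodule by which one divides; \<open>+\<close> is the elementwise sum of sets.\<close>

definition relations :: "nat \<Rightarrow> enat \<Rightarrow> MM set" where
  "relations r e = (case e of enat k \<Rightarrow> CC r + VV k | \<infinity> \<Rightarrow> CC r)"

text \<open>
  The quotient of \<^typ>\<open>MM\<close> by \<open>relations r e\<close> is the set \<open>Mbar r e\<close> of cosets. Its addition is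
  the elementwise sum. Scaling and the action map a coset to the union of the cosets of the
  results, taken over all representatives.
\<close>

definition proj :: "nat \<Rightarrow> enat \<Rightarrow> MM \<Rightarrow> MM set" where
  "proj r e m = m +o relations r e"

definition Mbar :: "nat \<Rightarrow> enat \<Rightarrow> MM set set" where
  "Mbar r e = range (proj r e)"

definition Mbar_scale :: "nat \<Rightarrow> enat \<Rightarrow> rat \<Rightarrow> MM set \<Rightarrow> MM set" where
  "Mbar_scale r e c A = (\<Union>m\<in>A. proj r e (c *\<^sub>Q m))"

definition Mbar_act :: "nat \<Rightarrow> enat \<Rightarrow> HH \<Rightarrow> MM set \<Rightarrow> MM set" where
  "Mbar_act r e h A = (\<Union>m\<in>A. proj r e (h \<odot> m))"

lemma gl_submodule_Inter: "(\<And>N. N \<in> F \<Longrightarrow> gl_submodule N) \<Longrightarrow> gl_submodule (\<Inter>F)"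
  by (auto simp: gl_submodule_def rat_vec.subspace_def)

lemma gl_submodule_CC: "gl_submodule (CC r)"
  unfolding CC_def by (rule hull_in) (blast intro: gl_submodule_Inter)


section \<open>The maps rho and phi\<close>

text \<open>\<open>adj_partial l G v\<close> is the product of the \<open>partial (l e)\<close> over the edges \<open>e\<close> at \<open>v\<close>; the order
  of the factors is irrelevant.\<close>

interpretation partial_fold: comp_fun_commute "\<lambda>e. partial (l e)" for l :: "'e \<Rightarrow> 'n"
  by unfold_locales (auto simp: fun_eq_iff partial_commute)

definition adj_partial ::
  "('v set \<Rightarrow> 'n) \<Rightarrow> 'v graph \<Rightarrow> 'v \<Rightarrow> ('n, 'a::comm_ring_1) mpoly \<Rightarrow> ('n, 'a) mpoly" where
  "adj_partial l G v p = Finite_Set.fold (\<lambda>e. partial (l e)) p (adj_edges G v)"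

definition rho_tree :: "('n::finite, 'a::comm_rat_algebra) mpoly \<Rightarrow> utree \<Rightarrow> ('n, 'a) mpoly" where
  "rho_tree P T = (let G = rep_utree T in
     \<Sum>l \<in> edges G \<rightarrow>\<^sub>E UNIV. \<Prod>v\<in>verts G. adj_partial l G v P)"

definition rho :: "('n::finite, 'a::comm_rat_algebra) mpoly \<Rightarrow> MM \<Rightarrow> ('n, 'a) mpoly" where
  "rho P = lin_ext (rho_tree P)"

definition phi_tree ::
  "('n::finite, 'a::comm_rat_algebra) mpoly \<Rightarrow> rtree \<Rightarrow> ('n, 'a) mpoly \<Rightarrow> ('n, 'a) mpoly" where
  "phi_tree P S f = (let (G, rt) = rep_rtree S in
     \<Sum>l \<in> edges G \<rightarrow>\<^sub>E UNIV. (\<Prod>v\<in>verts G - {rt}. adj_partial l G v P) * adj_partial l G rt f)"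

definition phi ::
  "('n::finite, 'a::comm_rat_algebra) mpoly \<Rightarrow> HH \<Rightarrow> ('n, 'a) mpoly \<Rightarrow> ('n, 'a) mpoly" where
  "phi P h f = lin_ext (\<lambda>S. phi_tree P S f) h"

lemma diff_ops_zero: "(\<lambda>f. 0) \<in> (diff_ops :: (('a, 'b::comm_ring_1) mpoly \<Rightarrow> _) set)"
  proof -
  have "(*) 0 = (\<lambda>f :: ('a, 'b) mpoly. 0 :: ('a, 'b) mpoly)"
    by (simp add: fun_eq_iff)
  with diff_ops.mult[of "0 :: ('a, 'b) mpoly"] show ?thesis by simp
qed

lemma diff_ops_sum:
  "(\<And>i. i \<in> I \<Longrightarrow> A i \<in> diff_ops) \<Longrightarrow> (\<lambda>f. \<Sum>i\<in>I. A i f) \<in> diff_ops"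
  by (induction I rule: infinite_finite_induct) (auto intro: diff_ops_zero diff_ops.add)

lemma diff_ops_mult_left: "A \<in> diff_ops \<Longrightarrow> (\<lambda>f. g * A f) \<in> diff_ops"
  using diff_ops.comp[OF diff_ops.mult[of g]] by (simp add: o_def)

lemma adj_partial_diff_ops:
  fixes l :: "'v set \<Rightarrow> 'n"
  assumes "finite (adj_edges G v)"
  shows "adj_partial l G v \<in> (diff_ops :: (('n, 'a::comm_ring_1) mpoly \<Rightarrow> _) set)"
proof -
  have "(\<lambda>p. Finite_Set.fold (\<lambda>e. partial (l e)) p F) \<in> (diff_ops :: (('n, 'a) mpoly \<Rightarrow> _) set)" if "finite F" for F
    using that
  proof (induction F)
    case empty
    have "(*) 1 = (\<lambda>p :: ('n, 'a) mpoly. p)" by (simp add: fun_eq_iff)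
    then show ?case using diff_ops.mult[of "1 :: ('n, 'a) mpoly"] by simp
  next
    case (insert e F)
    then show ?case
      using diff_ops.comp[OF diff_ops.partial[of "l e"] insert.IH] by (simp add: o_def)
  qed
  from this[OF assms] show ?thesis
    by (simp add: adj_partial_def[abs_def])
qed

lemma phi_diff_ops: "phi P h \<in> diff_ops"
proof -
  have "phi_tree P S \<in> diff_ops" for S
  proof -
    obtain G rt where G: "rep_rtree S = (G, rt)" by fastforce
    have "is_tree G"
      using is_rooted_tree_rep_rtree[of S] by (simp add: G is_rooted_tree_def)
    then have "finite (adj_edges G rt)"
      by (simp add: adj_edges_def finite_edges)
    then show ?thesis
      unfolding phi_tree_def[abs_def] G Let_def prod.case
      by (intro diff_ops_sum diff_ops_mult_left adj_partial_diff_ops)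
  qed
  then have "(\<lambda>f. (c *\<^sub>Q 1) * phi_tree P S f) \<in> diff_ops" for c S
    by (rule diff_ops_mult_left)
  then have "(\<lambda>f. c *\<^sub>Q phi_tree P S f) \<in> diff_ops" for c S
    by (simp add: mult_scaleQ_left)
  then show ?thesis
    unfolding phi_def[abs_def] lin_ext_def by (rule diff_ops_sum)
qed

end

theory Submission
  imports Defs
begin

text \<open>
  By the Leibniz rule, applying \<open>\<phi>\<^sub>P(S)\<close> to \<open>\<rho>\<^sub>P(T)\<close> distributes the derivatives at the root of \<open>S\<close>
  over the vertices of \<open>T\<close> in all ways; each distribution is a grafting of \<open>S\<close> onto \<open>T\<close>, so \<open>\<rho>\<^sub>P\<close>
  intertwines the two actions and its kernel is a submodule. Summing the labels of the inner edges
  of a naked \<open>r\<close>-chain produces an entry of \<open>(Hess P)\<^sup>r\<close>; at a leaf, Euler's identity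
  \<open>(d - 1) D\<^sub>i P = \<Sum>\<^sub>k X\<^sub>k D\<^sub>k D\<^sub>i P\<close> supplies the missing factor. A vertex of degree above \<open>deg P\<close>
  contributes a vanishing derivative.
\<close>

section \<open>Iterated partial derivatives\<close>

text \<open>A naked chain with r vertices has only r - 1 edges, while the r-th power of
  \<open>Hess P\<close> has r factors. An interior vertex meets exactly two chain edges and gives
  one Hessian entry; each end must also give one, whose second index is not the label of a chain
  edge. At an end of degree 2 this index is the label of the edge leaving the chain; at a leaf it is
  the summation index of Euler's identity, whose division by d - 1 calls for d \<ge> 2 and rational
  scalars.

  Trees are isomorphism classes with chosen representatives, but a graft has its vertices in a sum
  type. Polynomials are therefore attached to concrete graphs and shown to be isomorphism invariant,
  and a graft is shown to be a tree before its class is taken. To compare grafting with the Leibniz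
  rule, the edges at the root of S are identified with the new edges of the graft, so that a
  labeling of the graft is a pair of labelings of S and T.

  \<open>VV e\<close> is defined as a mere span; its stability under the action has to be proved
  before the action descends to the quotient.\<close>

lemma lin_ext_hom:
  assumes add: "\<And>x y. L (x + y) = L x + L y"
    and scale: "\<And>c x. L (c *\<^sub>Q x) = c *\<^sub>Q L x"
  shows "L (lin_ext f m) = lin_ext (\<lambda>b. L (f b)) m"
proof -
  have "L 0 = 0" using add[of 0 0] by simp
  then have "L (sum g A) = (\<Sum>a\<in>A. L (g a))" for g :: "'c \<Rightarrow> 'a" and A
    by (induction A rule: infinite_finite_induct) (simp_all add: add)
  then show ?thesis by (simp add: lin_ext_def scale)
qed

lemma lin_ext_zero_fun: "(\<And>b. b \<in> Poly_Mapping.keys m \<Longrightarrow> f b = 0) \<Longrightarrow> lin_ext f m = 0"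
  by (simp add: lin_ext_def)

lemma lin_ext_fun_add: "lin_ext (\<lambda>b. f b + g b) m = lin_ext f m + lin_ext g m"
  by (simp add: lin_ext_def scaleQ_add_right sum.distrib)

lemma lin_ext_fun_scale: "lin_ext (\<lambda>b. c *\<^sub>Q f b) m = c *\<^sub>Q lin_ext f m"
  by (simp add: lin_ext_def rat_vec.scale_sum_right scaleQ_scaleQ mult.commute)

section \<open>Linearity and the Leibniz rule for one partial derivative\<close>

lemma partial_add: "partial i (p + q) = partial i p + partial i q"
  by (rule poly_mapping_eqI) (simp add: lookup_partial lookup_add distrib_left)

lemma partial_zero [simp]: "partial i 0 = 0"
  by (simp add: partial_def)

lemma partial_sum: "partial i (sum f A) = (\<Sum>a\<in>A. partial i (f a))"
  by (induction A rule: infinite_finite_induct) (simp_all add: partial_add)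

lemma mult_scaleQ_right: "x * (c *\<^sub>Q y) = c *\<^sub>Q (x * (y :: 'a::comm_rat_algebra))"
  by (metis mult.commute mult_scaleQ_left)

lemma partial_scale: "partial i (c *\<^sub>Q p) = c *\<^sub>Q partial i (p :: ('n, 'a::comm_rat_algebra) mpoly)"
  by (rule poly_mapping_eqI) (simp add: lookup_partial mult_scaleQ_right)

lemma partial_single:
  "partial i (Poly_Mapping.single m a) =
     Poly_Mapping.single (m - Poly_Mapping.single i 1) (of_nat (Poly_Mapping.lookup m i) * a)"
  by (cases "a = 0") (simp_all add: partial_def)

lemma poly_mapping_as_sum:
  "p = (\<Sum>m\<in>Poly_Mapping.keys p. Poly_Mapping.single m (Poly_Mapping.lookup p m))"
  by (rule poly_mapping_eqI)
     (auto simp: lookup_sum lookup_single when_def sum.delta in_keys_iff)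

lemma partial_mult_single:
  fixes a b :: "'a::comm_ring_1" and m k :: "'n \<Rightarrow>\<^sub>0 nat"
  defines "p \<equiv> Poly_Mapping.single m a" and "q \<equiv> Poly_Mapping.single k b"
  shows "partial i (p * q) = partial i p * q + p * partial i q"
proof -
  let ?e = "Poly_Mapping.single i (1 :: nat)"
  \<comment> \<open>Subtraction of exponents is truncated, so moving it past k can fail when m has
    exponent 0 at i; there the coefficient vanishes.\<close>
  have shift: "of_nat (Poly_Mapping.lookup m i) = (0 :: 'a) \<or> m + k - ?e = (m - ?e) + k"
    for m k :: "'n \<Rightarrow>\<^sub>0 nat"
    by (cases "Poly_Mapping.lookup m i = 0")
       (auto intro!: poly_mapping_eqI simp: lookup_add lookup_minus lookup_single when_def)
  have *: "Poly_Mapping.single (m + k - ?e) (of_nat (Poly_Mapping.lookup m i) * c) =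
      Poly_Mapping.single ((m - ?e) + k) (of_nat (Poly_Mapping.lookup m i) * (c :: 'a))" for m k c
    using shift[of m k] by auto
  have "partial i (p * q) =
      Poly_Mapping.single (m + k - ?e) (of_nat (Poly_Mapping.lookup m i) * (a * b)) +
      Poly_Mapping.single (k + m - ?e) (of_nat (Poly_Mapping.lookup k i) * (a * b))"
    by (simp add: p_def q_def mult_single partial_single single_add[symmetric] lookup_add
        distrib_right add.commute)
  also have "\<dots> = partial i p * q + p * partial i q"
    unfolding * by (simp add: p_def q_def partial_single mult_single ac_simps)
  finally show ?thesis .
qed

text \<open>Both sides are biadditive in p and q, so it is enough to compare them on monomials;
  \<open>expand\<close> carries out this reduction for an arbitrary biadditive f.\<close>

lemma partial_mult:
  fixes p q :: "('n, 'a::comm_ring_1) mpoly"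
  shows "partial i (p * q) = partial i p * q + p * partial i q"
proof -
  let ?s = "\<lambda>p m. Poly_Mapping.single m (Poly_Mapping.lookup (p :: ('n, 'a) mpoly) m)"
  have expand: "f p q = (\<Sum>m\<in>Poly_Mapping.keys p. \<Sum>k\<in>Poly_Mapping.keys q. f (?s p m) (?s q k))"
    if f1: "\<And>(A :: ('n \<Rightarrow>\<^sub>0 nat) set) g q. f (sum g A) q = (\<Sum>a\<in>A. f (g a) q)"
      and f2: "\<And>(A :: ('n \<Rightarrow>\<^sub>0 nat) set) g p. f p (sum g A) = (\<Sum>a\<in>A. f p (g a))"
    for f :: "('n, 'a) mpoly \<Rightarrow> ('n, 'a) mpoly \<Rightarrow> ('n, 'a) mpoly"
  proof -
    have "f p q = f (\<Sum>m\<in>Poly_Mapping.keys p. ?s p m) (\<Sum>k\<in>Poly_Mapping.keys q. ?s q k)"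
      by (simp only: poly_mapping_as_sum[symmetric])
    also have "\<dots> = (\<Sum>m\<in>Poly_Mapping.keys p. \<Sum>k\<in>Poly_Mapping.keys q. f (?s p m) (?s q k))"
      unfolding f1 unfolding f2 ..
    finally show ?thesis .
  qed
  have "partial i (p * q) =
      (\<Sum>m\<in>Poly_Mapping.keys p. \<Sum>k\<in>Poly_Mapping.keys q. partial i (?s p m * ?s q k))"
    by (rule expand[where f = "\<lambda>p q. partial i (p * q)"])
       (simp_all add: partial_sum sum_distrib_left sum_distrib_right)
  also have "\<dots> = (\<Sum>m\<in>Poly_Mapping.keys p. \<Sum>k\<in>Poly_Mapping.keys q.
      partial i (?s p m) * ?s q k + ?s p m * partial i (?s q k))"
    by (simp only: partial_mult_single)
  also have "\<dots> = partial i p * q + p * partial i q"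
    by (rule expand[where f = "\<lambda>p q. partial i p * q + p * partial i q", symmetric])
       (simp_all add: partial_sum sum_distrib_left sum_distrib_right sum.distrib)
  finally show ?thesis .
qed

text \<open>The differentiated factor is marked by an \<open>if\<close> instead of being pulled out,
  so that in \<open>partials_prod\<close> the sum over w becomes the choice of the factor hit by one
  more derivative.\<close>

lemma partial_prod:
  fixes g :: "'v \<Rightarrow> ('n, 'a::comm_ring_1) mpoly"
  assumes "finite V"
  shows "partial i (\<Prod>v\<in>V. g v) = (\<Sum>w\<in>V. \<Prod>v\<in>V. if v = w then partial i (g v) else g v)"
  using assms
proof (induction V)
  case empty
  show ?case using partial_mult[of i 1 "1 :: ('n, 'a) mpoly"] by simp
next
  case (insert x V)
  let ?h = "\<lambda>w v. if v = w then partial i (g v) else g v"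
  have "(\<Prod>v\<in>V. ?h x v) = (\<Prod>v\<in>V. g v)"
    by (rule prod.cong) (use insert.hyps in auto)
  moreover have "(\<Sum>w\<in>V. \<Prod>v\<in>insert x V. ?h w v) = (\<Sum>w\<in>V. g x * (\<Prod>v\<in>V. ?h w v))"
    by (rule sum.cong) (use insert.hyps in auto)
  moreover have "(\<Prod>v\<in>insert x V. ?h x v) = partial i (g x) * (\<Prod>v\<in>V. ?h x v)"
    using insert.hyps by simp
  ultimately have "(\<Sum>w\<in>insert x V. \<Prod>v\<in>insert x V. ?h w v) =
      partial i (g x) * (\<Prod>v\<in>V. g v) + g x * (\<Sum>w\<in>V. \<Prod>v\<in>V. ?h w v)"
    by (simp only: sum.insert[OF insert.hyps] sum_distrib_left)
  then show ?case
    using insert.hyps by (simp only: prod.insert[OF insert.hyps] partial_mult insert.IH)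
qed

text \<open>Frees \<open>adj_partial\<close> from the graph: grafting splits the edges at a vertex
  into two sets, and one of them is reindexed by children of a root.\<close>

definition partials :: "('e \<Rightarrow> 'n) \<Rightarrow> 'e set \<Rightarrow> ('n, 'a::comm_ring_1) mpoly \<Rightarrow> ('n, 'a) mpoly" where
  "partials l F p = Finite_Set.fold (\<lambda>e. partial (l e)) p F"

lemma adj_partial_eq: "adj_partial l G v p = partials l (adj_edges G v) p"
  by (simp add: adj_partial_def partials_def)

lemma partials_empty [simp]: "partials l {} p = p"
  by (simp add: partials_def)

lemma partials_insert:
  "finite F \<Longrightarrow> e \<notin> F \<Longrightarrow> partials l (insert e F) p = partial (l e) (partials l F p)"
  by (simp add: partials_def)

lemma partials_zero [simp]: "finite F \<Longrightarrow> partials l F 0 = 0"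
  by (induction F rule: finite_induct) (simp_all add: partials_insert)

lemma partials_add: "finite F \<Longrightarrow> partials l F (p + q) = partials l F p + partials l F q"
  by (induction F rule: finite_induct) (simp_all add: partials_insert partial_add)

lemma partials_scale:
  "finite F \<Longrightarrow> partials l F (c *\<^sub>Q p) = c *\<^sub>Q partials l F (p :: ('n, 'a::comm_rat_algebra) mpoly)"
  by (induction F rule: finite_induct) (simp_all add: partials_insert partial_scale)

lemma partials_sum: "finite F \<Longrightarrow> partials l F (sum f A) = (\<Sum>a\<in>A. partials l F (f a))"
  by (induction A rule: infinite_finite_induct) (simp_all add: partials_add)

lemma partials_Un:
  assumes "finite F" "finite F'" "F \<inter> F' = {}"
  shows "partials l (F \<union> F') p = partials l F (partials l F' p)"
  using assms by (induction F rule: finite_induct) (simp_all add: partials_insert)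

lemma partials_image:
  assumes "finite F" "inj_on b F"
  shows "partials l (b ` F) p = partials (\<lambda>e. l (b e)) F p"
  using assms by (induction F rule: finite_induct) (simp_all add: partials_insert)

lemma partials_cong:
  assumes "finite F" "\<And>e. e \<in> F \<Longrightarrow> l e = l' e"
  shows "partials l F p = partials l' F p"
  using assms by (induction F rule: finite_induct) (simp_all add: partials_insert)

text \<open>Peels off a single choice. It serves both for attachment maps (the vertex hit by one
  derivative) and for labelings (the label of one edge).\<close>

lemma sum_PiE_insert:
  assumes "x \<notin> A"
  shows "(\<Sum>f\<in>insert x A \<rightarrow>\<^sub>E B. F f) = (\<Sum>f\<in>A \<rightarrow>\<^sub>E B. \<Sum>b\<in>B. F (f(x := b)))"
proof -
  have "(\<Sum>f\<in>insert x A \<rightarrow>\<^sub>E B. F f) = (\<Sum>(b, f)\<in>B \<times> (A \<rightarrow>\<^sub>E B). F (f(x := b)))"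
    unfolding PiE_insert_eq
    using inj_combinator[OF assms, of "\<lambda>_. B"]
    by (subst sum.reindex) (auto simp: case_prod_unfold)
  also have "\<dots> = (\<Sum>b\<in>B. \<Sum>f\<in>A \<rightarrow>\<^sub>E B. F (f(x := b)))"
    by (simp add: sum.cartesian_product)
  also have "\<dots> = (\<Sum>f\<in>A \<rightarrow>\<^sub>E B. \<Sum>b\<in>B. F (f(x := b)))"
    by (rule sum.swap)
  finally show ?thesis .
qed

text \<open>Iterated Leibniz rule, with \<nu> recording which factor each derivative hits. When C is
  the set of children of a root and V the vertex set of a tree, these \<nu> are exactly the
  attachment maps of \<open>graft\<close>.\<close>

lemma partials_prod:
  assumes "finite C" "finite V"
  shows "partials l C (\<Prod>v\<in>V. g v) =
    (\<Sum>\<nu>\<in>C \<rightarrow>\<^sub>E V. \<Prod>v\<in>V. partials l {c \<in> C. \<nu> c = v} (g v))"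
  using assms(1)
proof (induction C)
  case empty
  then show ?case by simp
next
  case (insert c C)
  have upd: "partials l {x \<in> insert c C. (\<nu>(c := w)) x = v} (g v) =
      (if v = w then partial (l c) (partials l {x \<in> C. \<nu> x = v} (g v))
       else partials l {x \<in> C. \<nu> x = v} (g v))" for \<nu> v w
  proof -
    have "{x \<in> insert c C. (\<nu>(c := w)) x = v} =
        (if v = w then insert c {x \<in> C. \<nu> x = v} else {x \<in> C. \<nu> x = v})"
      using insert.hyps by auto
    then show ?thesis using insert.hyps by (simp add: partials_insert)
  qed
  show ?case
    unfolding sum_PiE_insert[OF insert.hyps(2)] upd
    using insert.hyps assms(2)
    by (simp add: partials_insert insert.IH partial_sum partial_prod)
qed

section \<open>Grafting\<close>

text \<open>Connectedness of a graft is proved with reflexive transitive closures: they compose by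
  transitivity and reverse by symmetry, without splicing vertex lists.\<close>

lemma walk_imp_rtrancl:
  assumes "walk G vs"
  shows "(hd vs, last vs) \<in> {(u, v). {u, v} \<in> edges G}\<^sup>*"
proof -
  have "vs \<noteq> []" "successively (\<lambda>u v. {u, v} \<in> edges G) vs"
    using assms by (simp_all add: walk_def)
  then show ?thesis
  proof (induction vs rule: induct_list012)
    case (3 x y zs)
    then have "(x, y) \<in> {(u, v). {u, v} \<in> edges G}"
      "(y, last (y # zs)) \<in> {(u, v). {u, v} \<in> edges G}\<^sup>*" by auto
    then show ?case by (simp add: converse_rtrancl_into_rtrancl)
  qed auto
qed

lemma rtrancl_imp_walk:
  assumes "(u, v) \<in> {(u, v). {u, v} \<in> edges G}\<^sup>*" "v \<in> verts G"
    and "\<And>e. e \<in> edges G \<Longrightarrow> e \<subseteq> verts G"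
  shows "\<exists>vs. walk G vs \<and> hd vs = u \<and> last vs = v"
  using assms(1)
proof (induction rule: converse_rtrancl_induct)
  case base
  show ?case using assms(2) by (intro exI[of _ "[v]"]) (simp add: walk_def)
next
  case (step x y)
  then obtain vs where "walk G vs" "hd vs = y" "last vs = v" by blast
  with step.hyps(1) assms(3)[of "{x, y}"] show ?case
    by (intro exI[of _ "x # vs"]) (cases vs, auto simp: walk_def)
qed

text \<open>Lets a cycle in a graft be cut open at a place where it passes between the two
  sides.\<close>

lemma cycle_rotate:
  assumes "cycle G (xs @ ys)"
  shows "cycle G (ys @ xs)"
proof (cases "xs = [] \<or> ys = []")
  case False
  then show ?thesis
    using assms by (auto simp: cycle_def walk_def successively_append_iff insert_commute)
qed (use assms in auto)

lemma children_iff: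
  assumes "is_rooted_tree S"
  shows "c \<in> children S \<longleftrightarrow> {snd S, c} \<in> edges (fst S)"
  using assms tree_edges_subset[of "fst S" "{snd S, c}"]
  by (auto simp: children_def is_rooted_tree_def)

lemma children_not_root:
  assumes "is_rooted_tree S" "c \<in> children S"
  shows "c \<noteq> snd S"
proof
  assume "c = snd S"
  then have "{snd S} \<in> edges (fst S)" using assms by (simp add: children_def)
  then show False
    using assms(1) is_treeD(3)[of "fst S" "{snd S}"] by (auto simp: is_rooted_tree_def)
qed

lemma edge_graft:
  shows "{Inl x, Inl y} \<in> edges (graft S \<nu> T) \<longleftrightarrow>
      {x, y} \<in> edges (fst S) \<and> x \<noteq> snd S \<and> y \<noteq> snd S"
    and "{Inr v, Inr w} \<in> edges (graft S \<nu> T) \<longleftrightarrow> {v, w} \<in> edges T"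
    and "{Inl x, Inr w} \<in> edges (graft S \<nu> T) \<longleftrightarrow> x \<in> children S \<and> w = \<nu> x"
    and "{Inr w, Inl x} \<in> edges (graft S \<nu> T) \<longleftrightarrow> x \<in> children S \<and> w = \<nu> x"
proof -
  have l: "({Inl x, Inl y} = Inl ` e) = (e = {x, y})" for x y :: 'a and e
    using inj_image_eq_iff[of Inl "{x, y}" e] by auto
  have r: "({Inr x, Inr y} = Inr ` e) = (e = {x, y})" for x y :: 'b and e
    using inj_image_eq_iff[of Inr "{x, y}" e] by auto
  show "{Inl x, Inl y} \<in> edges (graft S \<nu> T) \<longleftrightarrow>
      {x, y} \<in> edges (fst S) \<and> x \<noteq> snd S \<and> y \<noteq> snd S"
    by (auto simp: graft_def image_iff l doubleton_eq_iff)
  show "{Inr v, Inr w} \<in> edges (graft S \<nu> T) \<longleftrightarrow> {v, w} \<in> edges T"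
    by (auto simp: graft_def image_iff r doubleton_eq_iff)
  show *: "{Inl x, Inr w} \<in> edges (graft S \<nu> T) \<longleftrightarrow> x \<in> children S \<and> w = \<nu> x"
    by (auto simp: graft_def image_iff doubleton_eq_iff)
  show "{Inr w, Inl x} \<in> edges (graft S \<nu> T) \<longleftrightarrow> x \<in> children S \<and> w = \<nu> x"
    using * by (simp add: insert_commute)
qed

text \<open>A cycle on one side would be a cycle of S or of T. A mixed cycle contains a run of
  vertices of S between two vertices of T; both ends of the run are children of the root, so the
  root closes the run to a cycle of S.\<close>

lemma not_cycle_graft:
  assumes S: "is_rooted_tree S" and T: "is_tree T"
  shows "\<not> cycle (graft S \<nu> T) vs"
proof
  assume cyc: "cycle (graft S \<nu> T) vs"
  have vs: "set vs \<subseteq> verts (graft S \<nu> T)" "vs \<noteq> []" "distinct vs" "3 \<le> length vs"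
    using cyc by (auto simp: cycle_def walk_def)
  have S': "is_tree (fst S)" "snd S \<in> verts (fst S)" using S by (auto simp: is_rooted_tree_def)
  consider "set vs \<subseteq> range Inl" | "set vs \<subseteq> range Inr"
    | w x where "Inr w \<in> set vs" "Inl x \<in> set vs"
    by (smt (verit) old.sum.exhaust rangeI subsetI)
  then show False
  proof cases
    case 1
    then have "\<exists>us. vs = map Inl us" unfolding ex_map_conv by auto
    then obtain us where us: "vs = map Inl us" by blast
    then have "cycle (fst S) us"
      using cyc by (auto simp: cycle_def walk_def successively_map edge_graft distinct_map
          last_map hd_map graft_def[THEN arg_cong[where f = fst]] elim: successively_mono)
    then show False using is_treeD(5)[OF S'(1)] by simp
  next
    case 2
    then have "\<exists>us. vs = map Inr us" unfolding ex_map_conv by auto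
    then obtain us where us: "vs = map Inr us" by blast
    then have "cycle T us"
      using cyc by (auto simp: cycle_def walk_def successively_map edge_graft distinct_map
          last_map hd_map graft_def[THEN arg_cong[where f = fst]])
    then show False using is_treeD(5)[OF T] by simp
  next
    case 3
    obtain xs ys where "vs = xs @ Inr w # ys" using 3(1) by (meson split_list)
    then have c1: "cycle (graft S \<nu> T) (ys @ xs @ [Inr w])"
      using cyc cycle_rotate[of _ "xs @ [Inr w]" ys] by simp
    \<comment> \<open>Moving the leading vertices of T to the back gives a rotation that begins in S
      and ends in T.\<close>
    define ps where "ps = takeWhile (\<lambda>z. \<not> isl z) (ys @ xs @ [Inr w])"
    define qs where "qs = dropWhile (\<lambda>z. \<not> isl z) (ys @ xs @ [Inr w])"
    have pq: "ys @ xs @ [Inr w] = ps @ qs" by (simp add: ps_def qs_def)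
    have "Inl x \<in> set (ys @ xs @ [Inr w])" using 3(2) \<open>vs = _\<close> by auto
    then have "qs \<noteq> []"
      unfolding qs_def dropWhile_eq_Nil_conv by (metis sum.disc(1))
    then have q: "qs \<noteq> []" "isl (hd qs)"
      using hd_dropWhile[of "\<lambda>z. \<not> isl z" "ys @ xs @ [Inr w]"] unfolding qs_def by blast+
    have lastqp: "\<not> isl (last (qs @ ps))"
    proof (cases "ps = []")
      case True
      then have "last (qs @ ps) = Inr w" using arg_cong[OF pq, of last] by simp
      then show ?thesis by simp
    next
      case False
      then have "last ps \<in> set ps" by simp
      then have "\<not> isl (last ps)" unfolding ps_def by (blast dest: set_takeWhileD)
      then show ?thesis using False by simp
    qed
    have c2: "cycle (graft S \<nu> T) (qs @ ps)" using c1 unfolding pq by (rule cycle_rotate)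
    \<comment> \<open>The first run inside S. The remainder \<open>bs\<close> may return to S, but
      it begins and ends in T.\<close>
    define as where "as = takeWhile isl (qs @ ps)"
    define bs where "bs = dropWhile isl (qs @ ps)"
    have ab: "qs @ ps = as @ bs" by (simp add: as_def bs_def)
    have as: "as \<noteq> []" using q by (cases qs) (auto simp: as_def)
    have "last (qs @ ps) \<in> set (qs @ ps)" using q(1) by (intro last_in_set) simp
    then have bs: "bs \<noteq> []" unfolding bs_def using lastqp by (auto simp: dropWhile_eq_Nil_conv)
    then have hdbs: "\<not> isl (hd bs)" unfolding bs_def by (rule hd_dropWhile)
    have "set as \<subseteq> range Inl" unfolding as_def by (auto dest!: set_takeWhileD simp: isl_def)
    then have "\<exists>us. as = map Inl us" unfolding ex_map_conv by auto
    then obtain us where us: "as = map Inl us" by blast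
    then have usne: "us \<noteq> []" using as by simp
    obtain w1 where w1: "hd bs = Inr w1" using hdbs by (cases "hd bs") auto
    obtain w2 where w2: "last bs = Inr w2"
      using lastqp bs unfolding ab by (cases "last bs") auto
    note c = c2[unfolded ab us]
    have e1: "last us \<in> children S" "w1 = \<nu> (last us)"
      using c bs usne w1
      by (auto simp: cycle_def walk_def successively_append_iff last_map edge_graft)
    have e2: "hd us \<in> children S" "w2 = \<nu> (hd us)"
      using c bs usne w2 by (auto simp: cycle_def hd_map edge_graft)
    show False
    \<comment> \<open>A run of one child c has \<nu> c as its neighbour on both sides, so the cycle
      would have only two vertices. A longer run together with the root has at least three.\<close>
    proof (cases "length us = 1")
      case True
      then have "last us = hd us" by (cases us) auto
      then have "hd bs = last bs" using e1 e2 w1 w2 by simp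
      moreover have "distinct bs" using c by (simp add: cycle_def)
      ultimately have "length bs = 1"
        using bs by (cases bs) (auto split: if_splits)
      with True c show False by (simp add: cycle_def)
    next
      case False
      then have len: "2 \<le> length us" using usne by (cases us) (auto simp: Suc_le_eq)
      have "set us \<subseteq> verts (fst S) - {snd S}" "distinct us"
        "successively (\<lambda>u v. {u, v} \<in> edges (fst S)) us"
        using c by (auto simp: cycle_def walk_def graft_def[THEN arg_cong[where f = fst]]
            successively_append_iff successively_map edge_graft distinct_map
            elim: successively_mono)
      moreover have "{snd S, hd us} \<in> edges (fst S)" "{last us, snd S} \<in> edges (fst S)"
        using e1 e2 S by (auto simp: children_iff insert_commute)
      ultimately have "cycle (fst S) (snd S # us)"
        using S'(2) len usne by (cases us) (auto simp: cycle_def walk_def)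
      then show False using is_treeD(5)[OF S'(1)] by simp
    qed
  qed
qed

text \<open>\<open>utree_of_eq_iff\<close> speaks only about trees, so this is what makes the
  classes occurring in \<open>gl_tree\<close> accessible.\<close>

lemma is_tree_graft:
  assumes S: "is_rooted_tree S" and T: "is_tree T" and \<nu>: "\<nu> \<in> children S \<rightarrow> verts T"
  shows "is_tree (graft S \<nu> T)"
proof (rule is_treeI)
  let ?G = "graft S \<nu> T"
  let ?R = "{(u, v). {u, v} \<in> edges ?G}"
  have S': "is_tree (fst S)" "snd S \<in> verts (fst S)" using S by (auto simp: is_rooted_tree_def)
  have V: "verts ?G = Inl ` (verts (fst S) - {snd S}) \<union> Inr ` verts T"
    by (simp add: graft_def)
  show "finite (verts ?G)" "verts ?G \<noteq> {}"
    unfolding V using is_treeD(1)[OF S'(1)] is_treeD(1,2)[OF T] by auto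
  show edge: "\<exists>u v. e = {u, v} \<and> u \<in> verts ?G \<and> v \<in> verts ?G \<and> u \<noteq> v" if e: "e \<in> edges ?G" for e
  proof -
    consider e' where "e = Inl ` e'" "e' \<in> edges (fst S)" "snd S \<notin> e'"
      | e' where "e = Inr ` e'" "e' \<in> edges T"
      | c where "e = {Inl c, Inr (\<nu> c)}" "c \<in> children S"
      using e by (auto simp: graft_def)
    then show ?thesis
    proof cases
      case 1
      obtain u v where "e' = {u, v}" "u \<in> verts (fst S)" "v \<in> verts (fst S)" "u \<noteq> v"
        using is_treeD(3)[OF S'(1) 1(2)] by blast
      with 1 show ?thesis
        unfolding V by (intro exI[of _ "Inl u"] exI[of _ "Inl v"]) auto
    next
      case 2
      obtain u v where "e' = {u, v}" "u \<in> verts T" "v \<in> verts T" "u \<noteq> v"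
        using is_treeD(3)[OF T 2(2)] by blast
      with 2 show ?thesis
        unfolding V by (intro exI[of _ "Inr u"] exI[of _ "Inr v"]) auto
    next
      case 3
      with \<nu> children_not_root[OF S 3(2)] show ?thesis
        unfolding V by (intro exI[of _ "Inl c"] exI[of _ "Inr (\<nu> c)"]) (auto simp: children_def)
    qed
  qed
  \<comment> \<open>Every vertex is linked to one fixed vertex t of T; symmetry then links any
    two.\<close>
  obtain t where t: "t \<in> verts T" using is_treeD(2)[OF T] by auto
  have symR: "sym (?R\<^sup>*)" by (intro sym_rtrancl) (auto simp: sym_def insert_commute)
  have r: "(Inr w, Inr t) \<in> ?R\<^sup>*" if w: "w \<in> verts T" for w
  proof -
    obtain vs where "walk T vs" "hd vs = w" "last vs = t" using is_treeD(4)[OF T w t] by blast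
    then have "(w, t) \<in> {(u, v). {u, v} \<in> edges T}\<^sup>*" using walk_imp_rtrancl by blast
    then show ?thesis
    proof (induction rule: converse_rtrancl_induct)
      case (step x y)
      then have "(Inr x, Inr y) \<in> ?R" by (simp add: edge_graft)
      then show ?case using step.IH by (rule converse_rtrancl_into_rtrancl)
    qed simp
  qed
  have l: "(Inl x, Inr t) \<in> ?R\<^sup>*" if x: "x \<in> verts (fst S)" "x \<noteq> snd S" for x
  proof -
    obtain vs where "walk (fst S) vs" "hd vs = x" "last vs = snd S"
      using is_treeD(4)[OF S'(1) x(1) S'(2)] by blast
    then have "(x, snd S) \<in> {(u, v). {u, v} \<in> edges (fst S)}\<^sup>*" using walk_imp_rtrancl[of "fst S" vs] by simp
    then show ?thesis using x(2)
    proof (induction rule: converse_rtrancl_induct)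
      case (step x y)
      show ?case
      proof (cases "y = snd S")
        \<comment> \<open>The walk in S reaches the deleted root here; the new edge from x to \<nu>
          x replaces this last step.\<close>
        case True
        then have c: "x \<in> children S" using step by (simp add: children_iff[OF S] insert_commute)
        then have "(Inl x, Inr (\<nu> x)) \<in> ?R" by (simp add: edge_graft)
        then show ?thesis
          using r[of "\<nu> x"] c \<nu> by (blast intro: converse_rtrancl_into_rtrancl)
      next
        case False
        then have "(Inl x, Inl y) \<in> ?R" using step by (simp add: edge_graft)
        then show ?thesis using step False by (blast intro: converse_rtrancl_into_rtrancl)
      qed
    qed simp
  qed
  show "\<exists>vs. walk ?G vs \<and> hd vs = u \<and> last vs = v" if "u \<in> verts ?G" "v \<in> verts ?G" for u v
  proof (rule rtrancl_imp_walk)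
    have "(z, Inr t) \<in> ?R\<^sup>*" if "z \<in> verts ?G" for z
      using that l r unfolding V by auto
    with that symR show "(u, v) \<in> ?R\<^sup>*" by (meson rtrancl_trans symD)
    show "e \<subseteq> verts ?G" if "e \<in> edges ?G" for e using edge[OF that] by auto
  qed (rule that(2))
  show "\<not> cycle ?G vs" for vs using S T by (rule not_cycle_graft)
qed

section \<open>The action and the differential operators\<close>

text \<open>A labeling of a disjoint union of edge sets is a pair of labelings, where b1 and b2
  rename the edges of the parts as edges of the whole. Pullbacks are restricted because members of
  \<open>PiE\<close> take the value \<open>undefined\<close> off their domain.\<close>

lemma sum_PiE_two:
  assumes inj: "inj_on b1 A1" "inj_on b2 A2" and disj: "b1 ` A1 \<inter> b2 ` A2 = {}"
    and B: "B = b1 ` A1 \<union> b2 ` A2"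
    and F: "\<And>l. l \<in> B \<rightarrow>\<^sub>E C \<Longrightarrow> F l = F' (restrict (l \<circ> b1) A1) (restrict (l \<circ> b2) A2)"
  shows "(\<Sum>l\<in>B \<rightarrow>\<^sub>E C. F l) = (\<Sum>l1\<in>A1 \<rightarrow>\<^sub>E C. \<Sum>l2\<in>A2 \<rightarrow>\<^sub>E C. F' l1 l2)"
proof -
  let ?i = "\<lambda>(l1, l2). \<lambda>x\<in>B. if x \<in> b1 ` A1 then l1 (inv_into A1 b1 x) else l2 (inv_into A2 b2 x)"
  let ?j = "\<lambda>l. (restrict (l \<circ> b1) A1, restrict (l \<circ> b2) A2)"
  have inv1: "inv_into A1 b1 (b1 a) = a" if "a \<in> A1" for a using inj(1) that by simp
  have inv2: "inv_into A2 b2 (b2 a) = a" if "a \<in> A2" for a using inj(2) that by simp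
  have not1: "b2 a \<notin> b1 ` A1" if "a \<in> A2" for a using disj that by blast
  have "(\<Sum>l\<in>B \<rightarrow>\<^sub>E C. F l) = (\<Sum>(l1, l2)\<in>(A1 \<rightarrow>\<^sub>E C) \<times> (A2 \<rightarrow>\<^sub>E C). F' l1 l2)"
  proof (rule sum.reindex_bij_witness[where i = ?i and j = ?j])
    fix l assume l: "l \<in> B \<rightarrow>\<^sub>E C"
    show "?i (?j l) = l"
    proof
      fix x
      show "?i (?j l) x = l x"
      proof (cases "x \<in> B")
        case True
        then consider a where "a \<in> A1" "x = b1 a" | a where "a \<in> A2" "x = b2 a"
          unfolding B by blast
        then show ?thesis using True by cases (simp_all add: inv1 inv2 not1)
      next
        case False
        with l show ?thesis by (simp add: PiE_arb[OF l])
      qed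
    qed
    show "?j l \<in> (A1 \<rightarrow>\<^sub>E C) \<times> (A2 \<rightarrow>\<^sub>E C)" using l unfolding B by auto
    show "(case ?j l of (l1, l2) \<Rightarrow> F' l1 l2) = F l" by (simp add: F[OF l])
  next
    fix p assume p: "p \<in> (A1 \<rightarrow>\<^sub>E C) \<times> (A2 \<rightarrow>\<^sub>E C)"
    obtain l1 l2 where [simp]: "p = (l1, l2)" by fastforce
    have l: "l1 \<in> A1 \<rightarrow>\<^sub>E C" "l2 \<in> A2 \<rightarrow>\<^sub>E C" using p by auto
    have "restrict (?i p \<circ> b1) A1 = l1"
      by (rule extensionalityI[of _ A1]) (use l in \<open>auto simp: B inv1 PiE_def\<close>)
    moreover have "restrict (?i p \<circ> b2) A2 = l2"
      by (rule extensionalityI[of _ A2]) (use l not1 in \<open>auto simp: B inv2 PiE_def\<close>)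
    ultimately show "?j (?i p) = p" by simp
    have "?i p x \<in> C" if "x \<in> B" for x
    proof -
      from that consider a where "a \<in> A1" "x = b1 a" | a where "a \<in> A2" "x = b2 a"
        unfolding B by blast
      then show ?thesis
        using that PiE_mem[OF l(1)] PiE_mem[OF l(2)] by cases (simp_all add: inv1 inv2 not1)
    qed
    then show "?i p \<in> B \<rightarrow>\<^sub>E C" by (intro PiE_I) simp_all
  qed
  then show ?thesis by (simp add: sum.cartesian_product)
qed

lemma sum_PiE_inj:
  assumes "inj_on b A" "\<And>l. l \<in> b ` A \<rightarrow>\<^sub>E C \<Longrightarrow> F l = F' (restrict (l \<circ> b) A)"
  shows "(\<Sum>l\<in>b ` A \<rightarrow>\<^sub>E C. F l) = (\<Sum>l\<in>A \<rightarrow>\<^sub>E C. F' l)"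
  using sum_PiE_two[of b A "b :: 'a \<Rightarrow> 'b" "{}" "b ` A" C F "\<lambda>l1 l2. F' l1"] assms by simp

text \<open>The polynomial of a concrete graph with vertices of any type, so that it applies to a
  graft before its isomorphism class is formed.\<close>

definition graph_poly ::
  "('n::finite, 'a::comm_rat_algebra) mpoly \<Rightarrow> 'v graph \<Rightarrow> ('n, 'a) mpoly" where
  "graph_poly P G = (\<Sum>l \<in> edges G \<rightarrow>\<^sub>E UNIV. \<Prod>v\<in>verts G. adj_partial l G v P)"

section \<open>Adjacent edges and isomorphism invariance of the polynomial of a tree\<close>

lemma finite_adj_edges: "is_tree G \<Longrightarrow> finite (adj_edges G v)"
  by (simp add: adj_edges_def finite_edges)

lemma adj_edges_subset: "adj_edges G v \<subseteq> edges G"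
  by (auto simp: adj_edges_def)

lemma adj_edges_iso:
  assumes G: "is_tree G" and f: "is_iso f G H" and v: "v \<in> verts G"
  shows "adj_edges H (f v) = (`) f ` adj_edges G v" "inj_on ((`) f) (edges G)"
proof -
  have inj: "inj_on f (verts G)" and E: "edges H = (`) f ` edges G"
    using f by (auto simp: is_iso_def bij_betw_def)
  have sub: "edges G \<subseteq> Pow (verts G)" using tree_edges_subset[OF G] by auto
  show "inj_on ((`) f) (edges G)"
    using inj_on_image_Pow[OF inj] sub by (rule inj_on_subset)
  have "f v \<in> f ` e \<longleftrightarrow> v \<in> e" if "e \<in> edges G" for e
    using inj_on_image_mem_iff[OF inj v] sub that by blast
  then show "adj_edges H (f v) = (`) f ` adj_edges G v"
    by (auto simp: adj_edges_def E)
qed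

text \<open>An isomorphism carries the edges at v to the edges at f v, so pulling labelings back
  along it matches the two sums term by term.\<close>

lemma graph_poly_iso:
  assumes G: "is_tree G" and f: "is_iso f G H"
  shows "graph_poly P H = graph_poly P G"
proof -
  have inj: "inj_on f (verts G)" and E: "edges H = (`) f ` edges G" and V: "verts H = f ` verts G"
    using f by (auto simp: is_iso_def bij_betw_def)
  have injE: "inj_on ((`) f) (edges G)"
    using adj_edges_iso(2)[OF G f] is_treeD(2)[OF G] by blast
  have "adj_partial l H (f v) P = adj_partial (restrict (l \<circ> (`) f) (edges G)) G v P"
    if v: "v \<in> verts G" for l v
  proof -
    have "adj_partial l H (f v) P = partials (\<lambda>e. l (f ` e)) (adj_edges G v) P"
      unfolding adj_partial_eq adj_edges_iso(1)[OF G f v]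
      by (rule partials_image[OF finite_adj_edges[OF G] inj_on_subset[OF injE adj_edges_subset]])
    also have "\<dots> = adj_partial (restrict (l \<circ> (`) f) (edges G)) G v P"
      unfolding adj_partial_eq
      by (rule partials_cong[OF finite_adj_edges[OF G]]) (simp add: adj_edges_def)
    finally show ?thesis .
  qed
  then show ?thesis
    unfolding graph_poly_def E V using inj by (intro sum_PiE_inj injE) (simp add: prod.reindex)
qed

lemma rho_tree_eq: "rho_tree P T = graph_poly P (rep_utree T)"
  by (simp add: rho_tree_def graph_poly_def Let_def)

lemma rho_tree_utree_of:
  assumes "is_tree G"
  shows "rho_tree P (utree_of G) = graph_poly P G"
proof -
  obtain f where f: "is_iso f (rep_utree (utree_of G)) G"
    using utree_of_eq_iff[OF assms, of "utree_of G"] by (auto simp: tree_iso_def)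
  show ?thesis by (simp add: rho_tree_eq graph_poly_iso[OF is_tree_rep_utree f])
qed

text \<open>Sends an edge of S to its counterpart in the graft. An edge from the root r to c loses r
  and gains \<nu> c, which makes it the new edge at c; any other edge is copied.\<close>

definition graft_edge :: "'v \<Rightarrow> ('v \<Rightarrow> 'w) \<Rightarrow> 'v set \<Rightarrow> ('v + 'w) set" where
  "graft_edge r \<nu> e = Inl ` (e - {r}) \<union> (if r \<in> e then Inr ` \<nu> ` (e - {r}) else {})"

section \<open>Edges and labelings of a graft\<close>

lemma root_edge:
  assumes S: "is_rooted_tree S" and e: "e \<in> edges (fst S)" "snd S \<in> e"
  obtains c where "c \<in> children S" "e = {snd S, c}" "e - {snd S} = {c}"
proof -
  obtain u v where "e = {u, v}" "u \<noteq> v"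
    using is_treeD(3)[of "fst S" e] S e by (auto simp: is_rooted_tree_def)
  with e(2) obtain c where c: "e = {snd S, c}" "c \<noteq> snd S" by auto
  show thesis by (rule that[of c]) (use c e children_iff[OF S] in auto)
qed

lemma edges_graft:
  assumes S: "is_rooted_tree S"
  shows "edges (graft S \<nu> T) = graft_edge (snd S) \<nu> ` edges (fst S) \<union> (`) Inr ` edges T"
proof -
  let ?E0 = "{e \<in> edges (fst S). snd S \<notin> e}" and ?E1 = "{e \<in> edges (fst S). snd S \<in> e}"
  have c: "graft_edge (snd S) \<nu> {snd S, c} = {Inl c, Inr (\<nu> c)}" if "c \<in> children S" for c
  proof -
    have "{snd S, c} - {snd S} = {c}" using children_not_root[OF S that] by auto
    then show ?thesis by (simp add: graft_edge_def insert_commute)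
  qed
  have E1: "?E1 = (\<lambda>c. {snd S, c}) ` children S"
    by (auto simp: children_iff[OF S] elim: root_edge[OF S])
  have "graft_edge (snd S) \<nu> ` ?E1 = {{Inl c, Inr (\<nu> c)} | c. c \<in> children S}"
    unfolding E1 image_image using c by (auto simp: image_iff)
  moreover have "graft_edge (snd S) \<nu> ` ?E0 = (`) Inl ` ?E0"
    by (rule image_cong) (auto simp: graft_edge_def)
  moreover have "edges (fst S) = ?E0 \<union> ?E1" by auto
  moreover have "graft_edge (snd S) \<nu> ` (?E0 \<union> ?E1) =
      graft_edge (snd S) \<nu> ` ?E0 \<union> graft_edge (snd S) \<nu> ` ?E1"
    by (rule image_Un)
  ultimately have "graft_edge (snd S) \<nu> ` edges (fst S) =
      (`) Inl ` ?E0 \<union> {{Inl c, Inr (\<nu> c)} | c. c \<in> children S}"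
    by simp
  then show ?thesis by (auto simp: graft_def)
qed

lemma inj_on_graft_edge:
  assumes S: "is_rooted_tree S"
  shows "inj_on (graft_edge (snd S) \<nu>) (edges (fst S))"
proof (rule inj_on_inverseI)
  fix e assume e: "e \<in> edges (fst S)"
  \<comment> \<open>An explicit left inverse: keep the S side, and put the root back exactly when
    the edge reaches into T.\<close>
  show "(Inl -` graft_edge (snd S) \<nu> e) \<union>
      (if graft_edge (snd S) \<nu> e \<subseteq> range Inl then {} else {snd S}) = e"
  proof (cases "snd S \<in> e")
    case True
    then obtain c where "e = {snd S, c}" "e - {snd S} = {c}" using root_edge[OF S e] by blast
    then show ?thesis by (auto simp: graft_edge_def)
  qed (auto simp: graft_edge_def)
qed

lemma adj_edges_root:
  assumes S: "is_rooted_tree S"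
  shows "adj_edges (fst S) (snd S) = (\<lambda>c. {snd S, c}) ` children S"
    "inj_on (\<lambda>c. {snd S, c}) (children S)"
  by (auto simp: adj_edges_def children_iff[OF S] inj_on_def doubleton_eq_iff elim: root_edge[OF S])

lemma adj_edges_graft_Inl:
  assumes S: "is_rooted_tree S" and "x \<noteq> snd S"
  shows "adj_edges (graft S \<nu> T) (Inl x) = graft_edge (snd S) \<nu> ` adj_edges (fst S) x"
  using assms(2) unfolding adj_edges_def edges_graft[OF S]
  by (auto simp: graft_edge_def)

text \<open>The first set gives the extra derivatives at w. It is indexed by the children sent to w,
  just as in the factor at w in \<open>partials_prod\<close>.\<close>

lemma adj_edges_graft_Inr:
  assumes S: "is_rooted_tree S"
  shows "adj_edges (graft S \<nu> T) (Inr w) =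
    (\<lambda>c. graft_edge (snd S) \<nu> {snd S, c}) ` {c \<in> children S. \<nu> c = w} \<union> (`) Inr ` adj_edges T w"
proof -
  have "{e \<in> edges (fst S). Inr w \<in> graft_edge (snd S) \<nu> e} =
      (\<lambda>c. {snd S, c}) ` {c \<in> children S. \<nu> c = w}" (is "?A = ?B")
  proof
    show "?A \<subseteq> ?B"
    proof
      fix e assume "e \<in> ?A"
      then have e: "e \<in> edges (fst S)" "snd S \<in> e" "w \<in> \<nu> ` (e - {snd S})"
        by (auto simp: graft_edge_def split: if_splits)
      then obtain c where "c \<in> children S" "e = {snd S, c}" "e - {snd S} = {c}"
        using root_edge[OF S] by blast
      with e(3) show "e \<in> ?B" by (auto intro: image_eqI[of _ _ c])
    qed
    show "?B \<subseteq> ?A"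
      using children_not_root[OF S] by (auto simp: graft_edge_def children_iff[OF S])
  qed
  moreover have "adj_edges (graft S \<nu> T) (Inr w) =
      graft_edge (snd S) \<nu> ` {e \<in> edges (fst S). Inr w \<in> graft_edge (snd S) \<nu> e} \<union>
      (`) Inr ` adj_edges T w"
    unfolding adj_edges_def edges_graft[OF S] by auto
  ultimately show ?thesis by (simp add: image_image)
qed

lemma finite_children: "is_rooted_tree S \<Longrightarrow> finite (children S)"
  using is_treeD(1)[of "fst S"] by (auto simp: is_rooted_tree_def children_def)

text \<open>Every edge of S has an end other than the root, and this end survives on the S
  side.\<close>

lemma graft_edge_Inr_disjoint:
  assumes S: "is_rooted_tree S"
  shows "graft_edge (snd S) \<nu> ` edges (fst S) \<inter> range ((`) Inr) = {}"
proof -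
  have "graft_edge (snd S) \<nu> e \<noteq> Inr ` e'" if e: "e \<in> edges (fst S)" for e e'
  proof -
    obtain u v where "e = {u, v}" "u \<noteq> v"
      using is_treeD(3)[of "fst S" e] S e by (auto simp: is_rooted_tree_def)
    then obtain c where "c \<in> e - {snd S}" by blast
    then have "Inl c \<in> graft_edge (snd S) \<nu> e" by (simp add: graft_edge_def)
    then show ?thesis by auto
  qed
  then show ?thesis by blast
qed

text \<open>The attachment \<nu> survives only in the sets of children hitting each w. Summing over
  \<nu> therefore leaves the product over S alone and turns the product over T into the right-hand
  side of \<open>partials_prod\<close>.\<close>

lemma graph_poly_graft:
  assumes S: "is_rooted_tree S" and T: "is_tree T" and \<nu>: "\<nu> \<in> children S \<rightarrow> verts T"
  shows "graph_poly P (graft S \<nu> T) =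
    (\<Sum>l1\<in>edges (fst S) \<rightarrow>\<^sub>E UNIV. \<Sum>l2\<in>edges T \<rightarrow>\<^sub>E UNIV.
      (\<Prod>x\<in>verts (fst S) - {snd S}. adj_partial l1 (fst S) x P) *
      (\<Prod>w\<in>verts T. partials (\<lambda>c. l1 {snd S, c}) {c \<in> children S. \<nu> c = w} (adj_partial l2 T w P)))"
  unfolding graph_poly_def
proof (rule sum_PiE_two[where ?b1.0 = "graft_edge (snd S) \<nu>" and ?b2.0 = "(`) Inr"])
  let ?G = "graft S \<nu> T" and ?b = "graft_edge (snd S) \<nu>"
  have S': "is_tree (fst S)" using S by (auto simp: is_rooted_tree_def)
  have injb: "inj_on ?b (edges (fst S))" by (rule inj_on_graft_edge[OF S])
  show "inj_on ?b (edges (fst S))" by (rule injb)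
  have injr: "inj ((`) Inr)" by (simp add: inj_image_eq_iff inj_def)
  then show "inj_on ((`) Inr) (edges T)" by (rule inj_on_subset) simp
  show "?b ` edges (fst S) \<inter> (`) Inr ` edges T = {}"
    using graft_edge_Inr_disjoint[OF S] by blast
  show "edges ?G = ?b ` edges (fst S) \<union> (`) Inr ` edges T" by (rule edges_graft[OF S])
  fix l :: "('a + 'b) set \<Rightarrow> 'c"
  let ?l1 = "restrict (l \<circ> ?b) (edges (fst S))" and ?l2 = "restrict (l \<circ> (`) Inr) (edges T)"
  have left: "adj_partial l ?G (Inl x) P = adj_partial ?l1 (fst S) x P" if "x \<noteq> snd S" for x
  proof -
    have "adj_partial l ?G (Inl x) P = partials (\<lambda>e. l (?b e)) (adj_edges (fst S) x) P"
      unfolding adj_partial_eq adj_edges_graft_Inl[OF S that]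
      by (rule partials_image[OF finite_adj_edges[OF S'] inj_on_subset[OF injb adj_edges_subset]])
    also have "\<dots> = adj_partial ?l1 (fst S) x P"
      unfolding adj_partial_eq
      by (rule partials_cong[OF finite_adj_edges[OF S']]) (simp add: adj_edges_def)
    finally show ?thesis .
  qed
  have right: "adj_partial l ?G (Inr w) P =
      partials (\<lambda>c. ?l1 {snd S, c}) {c \<in> children S. \<nu> c = w} (adj_partial ?l2 T w P)" for w
  proof -
    let ?C = "{c \<in> children S. \<nu> c = w}"
    have finC: "finite ?C" using finite_children[OF S] by simp
    have edgeC: "{snd S, c} \<in> edges (fst S)" if "c \<in> ?C" for c
      using that by (simp add: children_iff[OF S])
    have injC: "inj_on (\<lambda>c. ?b {snd S, c}) ?C"
    proof -
      have "inj_on (?b \<circ> (\<lambda>c. {snd S, c})) ?C"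
      proof (rule comp_inj_on)
        show "inj_on (\<lambda>c. {snd S, c}) ?C"
          using adj_edges_root(2)[OF S] by (rule inj_on_subset) auto
        show "inj_on ?b ((\<lambda>c. {snd S, c}) ` ?C)"
          using injb by (rule inj_on_subset) (use edgeC in auto)
      qed
      then show ?thesis by (simp add: o_def)
    qed
    have disj: "(\<lambda>c. ?b {snd S, c}) ` ?C \<inter> (`) Inr ` adj_edges T w = {}"
      using graft_edge_Inr_disjoint[OF S, of \<nu>] edgeC by blast
    have "adj_partial l ?G (Inr w) P = partials l ((\<lambda>c. ?b {snd S, c}) ` ?C)
        (partials l ((`) Inr ` adj_edges T w) P)"
      unfolding adj_partial_eq adj_edges_graft_Inr[OF S]
      by (rule partials_Un) (use finC finite_adj_edges[OF T] disj in auto)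
    also have "\<dots> = partials (\<lambda>c. l (?b {snd S, c})) ?C
        (partials (\<lambda>e. l (Inr ` e)) (adj_edges T w) P)"
      by (simp only: partials_image[OF finC injC]
          partials_image[OF finite_adj_edges[OF T] inj_on_subset[OF injr subset_UNIV]])
    also have "partials (\<lambda>e. l (Inr ` e)) (adj_edges T w) P = adj_partial ?l2 T w P"
      unfolding adj_partial_eq
      by (rule partials_cong[OF finite_adj_edges[OF T]]) (simp add: adj_edges_def)
    also have "partials (\<lambda>c. l (?b {snd S, c})) ?C (adj_partial ?l2 T w P) =
        partials (\<lambda>c. ?l1 {snd S, c}) ?C (adj_partial ?l2 T w P)"
      by (rule partials_cong[OF finC]) (use edgeC in simp)
    finally show ?thesis .
  qed
  have V: "verts ?G = Inl ` (verts (fst S) - {snd S}) \<union> Inr ` verts T"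
    by (simp add: graft_def)
  have "(\<Prod>v\<in>verts ?G. adj_partial l ?G v P) =
      (\<Prod>v\<in>Inl ` (verts (fst S) - {snd S}). adj_partial l ?G v P) *
      (\<Prod>v\<in>Inr ` verts T. adj_partial l ?G v P)"
    unfolding V using is_treeD(1)[OF S'] is_treeD(1)[OF T] by (intro prod.union_disjoint) auto
  also have "(\<Prod>v\<in>Inl ` (verts (fst S) - {snd S}). adj_partial l ?G v P) =
      (\<Prod>x\<in>verts (fst S) - {snd S}. adj_partial ?l1 (fst S) x P)"
    by (subst prod.reindex) (auto intro!: prod.cong simp: left)
  also have "(\<Prod>v\<in>Inr ` verts T. adj_partial l ?G v P) =
      (\<Prod>w\<in>verts T. partials (\<lambda>c. ?l1 {snd S, c}) {c \<in> children S. \<nu> c = w} (adj_partial ?l2 T w P))"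
    by (subst prod.reindex) (simp_all add: right)
  finally show "(\<Prod>v\<in>verts ?G. adj_partial l ?G v P) =
      (\<Prod>x\<in>verts (fst S) - {snd S}. adj_partial ?l1 (fst S) x P) *
      (\<Prod>w\<in>verts T. partials (\<lambda>c. ?l1 {snd S, c}) {c \<in> children S. \<nu> c = w} (adj_partial ?l2 T w P))" .
qed

lemma phi_tree_eq:
  "phi_tree P S f = (\<Sum>l\<in>edges (fst (rep_rtree S)) \<rightarrow>\<^sub>E UNIV.
     (\<Prod>v\<in>verts (fst (rep_rtree S)) - {snd (rep_rtree S)}. adj_partial l (fst (rep_rtree S)) v P) *
     adj_partial l (fst (rep_rtree S)) (snd (rep_rtree S)) f)"
  by (simp add: phi_tree_def case_prod_unfold Let_def)

lemma rho_gl_tree: "rho P (gl_tree S T) = phi_tree P S (rho_tree P T)"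
proof -
  define S' where "S' = rep_rtree S"
  define T' where "T' = rep_utree T"
  have S: "is_rooted_tree S'" and T: "is_tree T'"
    by (simp_all add: S'_def T'_def is_rooted_tree_rep_rtree is_tree_rep_utree)
  let ?N = "children S' \<rightarrow>\<^sub>E verts T'"
  let ?A = "\<lambda>l1. \<Prod>x\<in>verts (fst S') - {snd S'}. adj_partial l1 (fst S') x P"
  let ?d = "\<lambda>l1 c. l1 {snd S', c}"
  have adj: "adj_partial l1 (fst S') (snd S') f = partials (?d l1) (children S') f"
    for l1 and f :: "('a, 'b) mpoly"
    unfolding adj_partial_eq adj_edges_root(1)[OF S]
    by (rule partials_image[OF finite_children[OF S] adj_edges_root(2)[OF S]])
  have root: "adj_partial l1 (fst S') (snd S') (graph_poly P T') =
      (\<Sum>l2\<in>edges T' \<rightarrow>\<^sub>E UNIV. \<Sum>\<nu>\<in>?N.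
         \<Prod>w\<in>verts T'. partials (?d l1) {c \<in> children S'. \<nu> c = w} (adj_partial l2 T' w P))" for l1
    unfolding adj graph_poly_def partials_sum[OF finite_children[OF S]]
      partials_prod[OF finite_children[OF S] is_treeD(1)[OF T]] ..
  have add: "rho P (sum g A) = (\<Sum>a\<in>A. rho P (g a))" for g :: "(nat \<Rightarrow> nat) \<Rightarrow> MM" and A
    by (induction A rule: infinite_finite_induct)
       (simp_all add: rho_def lin_ext_add lin_ext_def[of _ 0])
  have "rho P (gl_tree S T) = (\<Sum>\<nu>\<in>?N. rho_tree P (utree_of (graft S' \<nu> T')))"
    unfolding gl_tree_def S'_def[symmetric] T'_def[symmetric] add by (simp add: rho_def)
  also have "\<dots> = (\<Sum>\<nu>\<in>?N. graph_poly P (graft S' \<nu> T'))"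
    by (intro sum.cong rho_tree_utree_of is_tree_graft[OF S T]) auto
  also have "\<dots> = (\<Sum>\<nu>\<in>?N. \<Sum>l1\<in>edges (fst S') \<rightarrow>\<^sub>E UNIV. \<Sum>l2\<in>edges T' \<rightarrow>\<^sub>E UNIV. ?A l1 *
      (\<Prod>w\<in>verts T'. partials (?d l1) {c \<in> children S'. \<nu> c = w} (adj_partial l2 T' w P)))"
    by (intro sum.cong graph_poly_graft[OF S T]) auto
  \<comment> \<open>The sum over attachments moves inside both label sums, where \<open>root\<close>
    recognises it as a Leibniz expansion.\<close>
  also have "\<dots> = (\<Sum>l1\<in>edges (fst S') \<rightarrow>\<^sub>E UNIV. \<Sum>l2\<in>edges T' \<rightarrow>\<^sub>E UNIV. \<Sum>\<nu>\<in>?N. ?A l1 *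
      (\<Prod>w\<in>verts T'. partials (?d l1) {c \<in> children S'. \<nu> c = w} (adj_partial l2 T' w P)))"
    by (subst sum.swap, rule sum.cong[OF refl], rule sum.swap)
  also have "\<dots> = (\<Sum>l1\<in>edges (fst S') \<rightarrow>\<^sub>E UNIV.
      ?A l1 * adj_partial l1 (fst S') (snd S') (graph_poly P T'))"
    unfolding root sum_distrib_left ..
  also have "\<dots> = phi_tree P S (rho_tree P T)"
    by (simp only: phi_tree_eq rho_tree_eq S'_def T'_def)
  finally show ?thesis .
qed

section \<open>Linear extension of the intertwining relation\<close>

lemma rho_add: "rho P (m + m') = rho P m + rho P m'"
  by (simp add: rho_def lin_ext_add)

lemma rho_scale: "rho P (c *\<^sub>Q m) = c *\<^sub>Q rho P m"
  by (simp add: rho_def lin_ext_scale)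

lemma rho_lin_ext: "rho P (lin_ext f m) = lin_ext (\<lambda>b. rho P (f b)) m"
  by (rule lin_ext_hom) (simp_all add: rho_add rho_scale)

lemma finite_adj_edges_rep: "finite (adj_edges (fst (rep_rtree S)) v)"
  using is_rooted_tree_rep_rtree[of S] by (simp add: finite_adj_edges is_rooted_tree_def)

lemma phi_tree_add: "phi_tree P S (f + g) = phi_tree P S f + phi_tree P S g"
  by (simp add: phi_tree_eq adj_partial_eq partials_add finite_adj_edges_rep distrib_left sum.distrib)

lemma phi_tree_scale: "phi_tree P S (c *\<^sub>Q f) = c *\<^sub>Q phi_tree P S f"
  by (simp add: phi_tree_eq adj_partial_eq partials_scale finite_adj_edges_rep mult_scaleQ_right
      rat_vec.scale_sum_right)

lemma rho_gl_act: "rho P (h \<odot> m) = phi P h (rho P m)"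
proof -
  have "phi_tree P S (rho P m) = lin_ext (\<lambda>T. rho P (gl_tree S T)) m" for S
    unfolding rho_gl_tree unfolding rho_def
    by (rule lin_ext_hom) (simp_all add: phi_tree_add phi_tree_scale)
  then show ?thesis by (simp add: gl_act_def phi_def rho_lin_ext)
qed

section \<open>Naked chains and powers of the Hessian\<close>

lemma monom_degree_add_single: "monom_degree (m + Poly_Mapping.single i 1) = monom_degree m + 1"
  by (simp add: monom_degree_def lookup_add lookup_single when_def sum.distrib)

lemma keys_partial: "m \<in> Poly_Mapping.keys (partial i p) \<Longrightarrow>
    m + Poly_Mapping.single i 1 \<in> Poly_Mapping.keys p"
  by (auto simp: in_keys_iff lookup_partial)

lemma homogeneous_partial: "homogeneous d p \<Longrightarrow> homogeneous (d - 1) (partial i p)"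
  unfolding homogeneous_def
  by (metis keys_partial monom_degree_add_single add_diff_cancel_right')

lemma of_nat_mult_scaleQ: "of_nat c * x = rat_of_nat c *\<^sub>Q (x :: 'a::comm_rat_algebra)"
  by (induction c) (simp_all add: scaleQ_add_left scaleQ_one distrib_right)

abbreviation var :: "'n \<Rightarrow> ('n, 'a::comm_ring_1) mpoly" where
  "var i \<equiv> Poly_Mapping.single (Poly_Mapping.single i 1) 1"

lemma var_mult_partial_single:
  "var k * partial k (Poly_Mapping.single m a) =
     Poly_Mapping.single m (of_nat (Poly_Mapping.lookup m k) * a)"
proof (cases "Poly_Mapping.lookup m k = 0")
  case False
  then have "Poly_Mapping.single k 1 + (m - Poly_Mapping.single k 1) = m"
    by (intro poly_mapping_eqI) (auto simp: lookup_add lookup_minus lookup_single when_def)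
  then show ?thesis by (simp add: partial_single mult_single)
qed (simp add: partial_single)

text \<open>Multiplying the k-th derivative of a monomial by its variable scales the monomial by its
  k-th exponent, and the exponents add up to d.\<close>

lemma euler:
  fixes p :: "('n::finite, 'a::comm_rat_algebra) mpoly"
  assumes "homogeneous d p"
  shows "(\<Sum>k\<in>UNIV. var k * partial k p) = rat_of_nat d *\<^sub>Q p"
proof -
  let ?s = "\<lambda>m. Poly_Mapping.single m (Poly_Mapping.lookup p m)"
  have "(\<Sum>k\<in>UNIV. var k * partial k p) =
      (\<Sum>k\<in>UNIV. var k * partial k (\<Sum>m\<in>Poly_Mapping.keys p. ?s m))"
    by (simp only: poly_mapping_as_sum[symmetric])
  also have "\<dots> = (\<Sum>k\<in>UNIV. \<Sum>m\<in>Poly_Mapping.keys p.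
      Poly_Mapping.single m (of_nat (Poly_Mapping.lookup m k) * Poly_Mapping.lookup p m))"
    by (simp only: partial_sum sum_distrib_left var_mult_partial_single)
  also have "\<dots> = (\<Sum>m\<in>Poly_Mapping.keys p. \<Sum>k\<in>UNIV.
      Poly_Mapping.single m (of_nat (Poly_Mapping.lookup m k) * Poly_Mapping.lookup p m))"
    by (rule sum.swap)
  also have "\<dots> = (\<Sum>m\<in>Poly_Mapping.keys p. of_nat d * ?s m)"
  proof (rule sum.cong[OF refl])
    fix m assume "m \<in> Poly_Mapping.keys p"
    then have d: "(\<Sum>k\<in>UNIV. Poly_Mapping.lookup m k) = d"
      using assms by (simp add: homogeneous_def monom_degree_def)
    have "(\<Sum>k\<in>UNIV. Poly_Mapping.single m (of_nat (Poly_Mapping.lookup m k) * Poly_Mapping.lookup p m)) =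
        Poly_Mapping.single m (\<Sum>k\<in>UNIV. of_nat (Poly_Mapping.lookup m k) * Poly_Mapping.lookup p m)"
      by (rule poly_mapping_eqI) (simp add: lookup_sum lookup_single when_def)
    also have "(\<Sum>k\<in>UNIV. of_nat (Poly_Mapping.lookup m k) * Poly_Mapping.lookup p m) =
        of_nat d * Poly_Mapping.lookup p m"
      unfolding d[symmetric] by (simp add: sum_distrib_right)
    also have "Poly_Mapping.single m (of_nat d * Poly_Mapping.lookup p m) = of_nat d * ?s m"
      by (simp add: mult_single flip: single_of_nat)
    finally show "(\<Sum>k\<in>UNIV. Poly_Mapping.single m (of_nat (Poly_Mapping.lookup m k) * Poly_Mapping.lookup p m)) =
        of_nat d * ?s m" .
  qed
  also have "\<dots> = of_nat d * (\<Sum>m\<in>Poly_Mapping.keys p. ?s m)" by (simp only: sum_distrib_left)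
  also have "\<dots> = of_nat d * p" by (simp only: poly_mapping_as_sum[symmetric])
  finally show ?thesis by (simp only: of_nat_mult_scaleQ)
qed

text \<open>The derivative is homogeneous of degree d - 1, a nonzero rational because 2 \<le> d. On
  the right every term carries an entry of the Hessian.\<close>

lemma euler_partial:
  fixes p :: "('n::finite, 'a::comm_rat_algebra) mpoly"
  assumes "homogeneous d p" "2 \<le> d"
  shows "partial j p = (\<Sum>k\<in>UNIV. (1 / rat_of_nat (d - 1)) *\<^sub>Q var k * partial k (partial j p))"
proof -
  have "(\<Sum>k\<in>UNIV. (1 / rat_of_nat (d - 1)) *\<^sub>Q var k * partial k (partial j p)) =
      (1 / rat_of_nat (d - 1)) *\<^sub>Q (\<Sum>k\<in>UNIV. var k * partial k (partial j p))"
    by (simp only: mult_scaleQ_left rat_vec.scale_sum_right)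
  also have "\<dots> = (1 / rat_of_nat (d - 1)) *\<^sub>Q rat_of_nat (d - 1) *\<^sub>Q partial j p"
    by (simp only: euler[OF homogeneous_partial[OF assms(1)]])
  also have "\<dots> = partial j p"
    using assms(2) by (simp add: scaleQ_scaleQ scaleQ_one)
  finally show ?thesis by simp
qed

text \<open>Sums over the labels of the listed edges by overwriting a given labeling, so that all
  other labels stay fixed and induction can follow the chain.\<close>

fun sum_labels :: "'e list \<Rightarrow> (('e \<Rightarrow> 'n::finite) \<Rightarrow> 'b::comm_monoid_add) \<Rightarrow> ('e \<Rightarrow> 'n) \<Rightarrow> 'b" where
  "sum_labels [] F l = F l"
| "sum_labels (e # es) F l = (\<Sum>j\<in>UNIV. sum_labels es F (l(e := j)))"

lemma sum_PiE_sum_labels: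
  assumes "distinct es" "set es \<inter> R = {}"
  shows "(\<Sum>l\<in>set es \<union> R \<rightarrow>\<^sub>E UNIV. F l) = (\<Sum>l\<in>R \<rightarrow>\<^sub>E UNIV. sum_labels es F l)"
  using assms
proof (induction es arbitrary: R)
  case (Cons e es)
  have "(\<Sum>l\<in>set (e # es) \<union> R \<rightarrow>\<^sub>E UNIV. F l) = (\<Sum>l\<in>set es \<union> insert e R \<rightarrow>\<^sub>E UNIV. F l)"
    by simp
  also have "\<dots> = (\<Sum>l\<in>insert e R \<rightarrow>\<^sub>E UNIV. sum_labels es F l)"
    by (rule Cons.IH) (use Cons.prems in auto)
  also have "\<dots> = (\<Sum>l\<in>R \<rightarrow>\<^sub>E UNIV. sum_labels (e # es) F l)"
    by (subst sum_PiE_insert) (use Cons.prems in auto)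
  finally show ?case .
qed simp

text \<open>Only labelings that agree with l off the list occur. This is what freezes factors
  independent of the chain labels.\<close>

lemma sum_labels_cong:
  assumes "\<And>l'. (\<And>x. x \<notin> set es \<Longrightarrow> l' x = l x) \<Longrightarrow> F l' = F' l'"
  shows "sum_labels es F l = sum_labels es F' l"
  using assms
proof (induction es arbitrary: l)
  case (Cons e es)
  have "sum_labels es F (l(e := j)) = sum_labels es F' (l(e := j))" for j
    by (rule Cons.IH, rule Cons.prems) simp
  then show ?case by simp
qed simp

lemma sum_labels_mult:
  "sum_labels es (\<lambda>l. c * F l) l = c * (sum_labels es F l :: 'b::comm_semiring_0)"
  by (induction es arbitrary: l) (simp_all add: sum_distrib_left)

lemma sum_labels_sum: "sum_labels es (\<lambda>l. \<Sum>k\<in>K. F k l) l = (\<Sum>k\<in>K. sum_labels es (F k) l)"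
  by (induction es arbitrary: l) (simp_all add: sum.swap[of _ K])

text \<open>The contribution of one index path from i to k to an entry of a matrix power; s edges
  serve as s inner indices and give s + 1 factors.\<close>

fun path_prod :: "'b::comm_ring_1 ^ 'n ^ 'n \<Rightarrow> 'n \<Rightarrow> 'e list \<Rightarrow> 'n \<Rightarrow> ('e \<Rightarrow> 'n) \<Rightarrow> 'b" where
  "path_prod A i [] k l = A $ i $ k"
| "path_prod A i (e # es) k l = A $ i $ l e * path_prod A (l e) es k l"

lemma matrix_pow_Suc_nth:
  "matrix_pow A (Suc n) $ i $ k = (\<Sum>j\<in>UNIV. A $ i $ j * matrix_pow A n $ j $ k)"
  by (simp add: matrix_pow_def matrix_matrix_mult_def)

text \<open>Summing over inner indices is matrix multiplication. Distinctness keeps the label j of e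
  from being overwritten while the later edges are summed.\<close>

lemma sum_labels_path_prod:
  assumes "distinct es"
  shows "sum_labels es (path_prod A i es k) l = matrix_pow A (Suc (length es)) $ i $ k"
  using assms
proof (induction es arbitrary: i l)
  case Nil
  then show ?case by (simp add: matrix_pow_def)
next
  case (Cons e es)
  have "sum_labels es (path_prod A i (e # es) k) (l(e := j)) =
      A $ i $ j * matrix_pow A (Suc (length es)) $ j $ k" for j
  proof -
    have "sum_labels es (path_prod A i (e # es) k) (l(e := j)) =
        sum_labels es (\<lambda>l'. A $ i $ j * path_prod A j es k l') (l(e := j))"
      by (rule sum_labels_cong) (use Cons.prems in simp)
    then show ?thesis using Cons by (simp add: sum_labels_mult)
  qed
  then show ?case
    by (simp only: sum_labels.simps list.size add_0_right add_Suc_right matrix_pow_Suc_nth[of A "Suc _"])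
qed

section \<open>Products of vertex factors along a chain\<close>

fun chain_edges :: "'v list \<Rightarrow> 'v set list" where
  "chain_edges (u # v # vs) = {u, v} # chain_edges (v # vs)"
| "chain_edges vs = []"

lemma length_chain_edges: "length (chain_edges vs) = length vs - 1"
  by (induction vs rule: chain_edges.induct) auto

lemma chain_edges_subset: "e \<in> set (chain_edges vs) \<Longrightarrow> e \<subseteq> set vs"
  by (induction vs rule: chain_edges.induct) auto

lemma chain_edges_snoc: "chain_edges (xs @ [a, b]) = chain_edges (xs @ [a]) @ [{a, b}]"
  by (induction xs rule: chain_edges.induct) auto

lemma distinct_chain_edges: "distinct vs \<Longrightarrow> distinct (chain_edges vs)"
  by (induction vs rule: chain_edges.induct) (auto dest: chain_edges_subset)

lemma successively_chain_edges:
  "successively (\<lambda>u v. {u, v} \<in> E) vs \<Longrightarrow> set (chain_edges vs) \<subseteq> E"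
  by (induction vs rule: chain_edges.induct) auto

text \<open>The vertex a is left out of the product; the label of its edge to b is the row index at
  which the path starts. The hypotheses range over decompositions of the list so that they pass to
  its tails.\<close>

lemma prod_chain_tail:
  fixes A :: "'b::comm_ring_1 ^ 'n::finite ^ 'n"
  assumes "distinct (a # b # ys)"
    and "\<And>xs u v w zs. a # b # ys = xs @ u # v # w # zs \<Longrightarrow> g v = A $ l {u, v} $ l {v, w}"
    and "\<And>xs u v. a # b # ys = xs @ [u, v] \<Longrightarrow> g v = (\<Sum>k\<in>UNIV. z k * A $ l {u, v} $ k)"
  shows "(\<Prod>v\<in>set (b # ys). g v) =
    (\<Sum>k\<in>UNIV. z k * path_prod A (l {a, b}) (chain_edges (b # ys)) k l)"
  using assms
proof (induction ys arbitrary: a b)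
  case Nil
  then show ?case using Nil.prems(3)[of "[]"] by simp
next
  case (Cons c ys)
  have "(\<Prod>v\<in>set (b # c # ys). g v) = g b * (\<Prod>v\<in>set (c # ys). g v)"
    using Cons.prems(1) by (subst list.set, subst prod.insert) auto
  also have "(\<Prod>v\<in>set (c # ys). g v) =
      (\<Sum>k\<in>UNIV. z k * path_prod A (l {b, c}) (chain_edges (c # ys)) k l)"
  proof (rule Cons.IH)
    show "distinct (b # c # ys)" using Cons.prems(1) by simp
    show "g v = A $ l {u, v} $ l {v, w}" if "b # c # ys = xs @ u # v # w # zs" for xs u v w zs
      using Cons.prems(2)[of "a # xs" u v w zs] that by simp
    show "g v = (\<Sum>k\<in>UNIV. z k * A $ l {u, v} $ k)" if "b # c # ys = xs @ [u, v]" for xs u v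
      using Cons.prems(3)[of "a # xs" u v] that by simp
  qed
  also have "g b = A $ l {a, b} $ l {b, c}" using Cons.prems(2)[of "[]" a b c ys] by simp
  finally show ?case by (simp add: sum_distrib_left ac_simps)
qed

lemma prod_chain:
  fixes A :: "'b::comm_ring_1 ^ 'n::finite ^ 'n"
  assumes "distinct (a # b # ys)"
    and "\<And>xs u v w zs. a # b # ys = xs @ u # v # w # zs \<Longrightarrow> g v = A $ l {u, v} $ l {v, w}"
    and "\<And>xs u v. a # b # ys = xs @ [u, v] \<Longrightarrow> g v = (\<Sum>k\<in>UNIV. z k * A $ l {u, v} $ k)"
    and "g a = (\<Sum>i\<in>UNIV. y i * A $ i $ l {a, b})"
  shows "(\<Prod>v\<in>set (a # b # ys). g v) =
    (\<Sum>i\<in>UNIV. y i * (\<Sum>k\<in>UNIV. z k * path_prod A i (chain_edges (a # b # ys)) k l))"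
proof -
  have "(\<Prod>v\<in>set (a # b # ys). g v) = g a * (\<Prod>v\<in>set (b # ys). g v)"
    using assms(1) by (subst list.set, subst prod.insert) auto
  also have "\<dots> = (\<Sum>i\<in>UNIV. y i * A $ i $ l {a, b}) *
      (\<Sum>k\<in>UNIV. z k * path_prod A (l {a, b}) (chain_edges (b # ys)) k l)"
    using prod_chain_tail[of a b ys g A l z] assms by simp
  also have "\<dots> = (\<Sum>i\<in>UNIV. y i * (\<Sum>k\<in>UNIV. z k * path_prod A i (chain_edges (a # b # ys)) k l))"
    unfolding sum_product by (simp add: sum_distrib_left ac_simps)
  finally show ?thesis .
qed

text \<open>Cutting out the loop between two visits to a vertex leaves a shorter walk with the same
  ends.\<close>

lemma geodesic_distinct:
  assumes "geodesic G vs"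
  shows "distinct vs"
proof (rule ccontr)
  assume "\<not> distinct vs"
  then obtain xs ys zs y where vs: "vs = xs @ [y] @ ys @ [y] @ zs"
    using not_distinct_decomp by blast
  let ?ws = "xs @ y # zs"
  have "walk G ?ws"
    using assms unfolding geodesic_def walk_def vs
    by (auto simp: successively_append_iff successively_Cons)
  moreover have "hd ?ws = hd vs" "last ?ws = last vs"
    unfolding vs by (cases xs; simp)+
  ultimately have "length vs \<le> length ?ws" using assms unfolding geodesic_def by blast
  then show False by (simp add: vs)
qed

lemma partials_pair:
  "e \<noteq> e' \<Longrightarrow> partials l {e, e'} P = Hess P $ l e $ l e'"
  by (simp add: partials_insert Hess_def)

text \<open>The weights are Euler's \<open>X\<^sub>k / (d - 1)\<close> at a leaf and select the label of the other
  edge at a vertex of degree \<open>2\<close>; either way they ignore the label of \<open>e\<close>.\<close>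

lemma chain_end_weights:
  fixes P :: "('n::finite, 'a::comm_rat_algebra) mpoly" and G :: "'v graph"
  assumes P: "homogeneous d P" "2 \<le> d"
    and deg: "vdegree G v \<in> {1, 2}" and e: "e \<in> adj_edges G v"
  obtains w :: "('v set \<Rightarrow> 'n) \<Rightarrow> 'n \<Rightarrow> ('n, 'a) mpoly" where
    "\<forall>l. adj_partial l G v P = (\<Sum>k\<in>UNIV. w l k * Hess P $ k $ l e)"
    "\<forall>l l'. (\<forall>e'\<in>adj_edges G v - {e}. l e' = l' e') \<longrightarrow> w l = w l'"
proof -
  have "card (adj_edges G v) = 1 \<or> card (adj_edges G v) = 2" using deg by (simp add: vdegree_def)
  then have "adj_edges G v = {e} \<or> (\<exists>e'. adj_edges G v = {e', e} \<and> e' \<noteq> e)"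
  proof
    assume "card (adj_edges G v) = 1"
    then show ?thesis using e by (auto simp: card_1_singleton_iff)
  next
    assume "card (adj_edges G v) = 2"
    then obtain x y where xy: "adj_edges G v = {x, y}" "x \<noteq> y" by (auto simp: card_2_iff)
    have "e = x \<or> e = y" using e xy by simp
    then show ?thesis using xy insert_commute[of x y "{}"] by metis
  qed
  then consider "adj_edges G v = {e}" | e' where "adj_edges G v = {e', e}" "e' \<noteq> e" by blast
  then show thesis
  proof cases
    case 1
    have "adj_partial l G v P = (\<Sum>k\<in>UNIV. (1 / rat_of_nat (d - 1)) *\<^sub>Q var k * Hess P $ k $ l e)" for l
      using euler_partial[OF P, of "l e"] by (simp add: adj_partial_eq 1 partials_insert Hess_def)
    then show thesis by (intro that[of "\<lambda>l k. (1 / rat_of_nat (d - 1)) *\<^sub>Q var k"]) simp_all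
  next
    case 2
    have "(\<Sum>k\<in>UNIV. of_bool (k = l e') * Hess P $ k $ l e) = Hess P $ l e' $ l e" for l :: "'v set \<Rightarrow> 'n"
      using sum.remove[of UNIV "l e'" "\<lambda>k. of_bool (k = l e') * Hess P $ k $ l e"] by simp
    then have "adj_partial l G v P = (\<Sum>k\<in>UNIV. of_bool (k = l e') * Hess P $ k $ l e)" for l
      by (simp add: adj_partial_eq 2 partials_pair)
    then show thesis by (intro that[of "\<lambda>l k. of_bool (k = l e')"]) (use 2 in simp_all)
  qed
qed

text \<open>Each of the r chain vertices contributes one Hessian entry, up to weights at the two
  ends. For r \<ge> 2, summing the labels of the r - 1 chain edges contracts these entries to
  entries of the r-th power.\<close>

lemma graph_poly_naked_chain:
  fixes P :: "('n::finite, 'a::comm_rat_algebra) mpoly" and G :: "'v graph"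
  assumes G: "is_tree G" and chain: "naked_chain r G vs" and "0 < r"
    and P: "homogeneous d P" "2 \<le> d" and nil: "matrix_pow (Hess P) r = 0"
  shows "graph_poly P G = 0"
proof -
  let ?A = "Hess P"
  have geo: "geodesic G vs" and len: "length vs = r"
    and deg: "vdegree G (hd vs) \<in> {1, 2}" "vdegree G (last vs) \<in> {1, 2}"
    and mid: "0 < i \<Longrightarrow> i < r - 1 \<Longrightarrow> vdegree G (vs ! i) = 2" for i
    using chain by (auto simp: naked_chain_def)
  have dist: "distinct vs" using geo by (rule geodesic_distinct)
  have walk: "set vs \<subseteq> verts G" "successively (\<lambda>u v. {u, v} \<in> edges G) vs" "vs \<noteq> []"
    using geo by (auto simp: geodesic_def walk_def)
  note fin = is_treeD(1)[OF G]
  obtain a vs' where vs': "vs = a # vs'" using walk(3) by (cases vs) auto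
  show ?thesis
  proof (cases vs')
    case Nil
    \<comment> \<open>For r = 1 no chain edge is available to sum over: the Hessian itself vanishes,
      and the factor at the single vertex is a combination of its entries.\<close>
    then have "?A = 0" using nil len vs' by (auto simp: matrix_pow_def)
    have "adj_edges G a \<noteq> {}" using deg(1) vs' by (auto simp: vdegree_def)
    then obtain e where e: "e \<in> adj_edges G a" by blast
    have "vdegree G a \<in> {1, 2}" using deg(1) vs' by simp
    with P obtain w :: "('v set \<Rightarrow> 'n) \<Rightarrow> 'n \<Rightarrow> ('n, 'a) mpoly" where
      "\<forall>l. adj_partial l G a P = (\<Sum>k\<in>UNIV. w l k * ?A $ k $ l e)"
      by (rule chain_end_weights[OF _ _ _ e])
    then have "adj_partial l G a P = 0" for l using \<open>?A = 0\<close> by simp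
    then have "(\<Prod>v\<in>verts G. adj_partial l G v P) = 0" for l
      using walk(1) vs' fin by (intro prod_zero) auto
    then show ?thesis by (simp add: graph_poly_def)
  next
    case (Cons b ys)
    have vs: "vs = a # b # ys" using vs' Cons by simp
    define es where "es = chain_edges vs"
    have es: "set es \<subseteq> edges G" "distinct es" "Suc (length es) = r"
      using successively_chain_edges[OF walk(2)] distinct_chain_edges[OF dist] len vs
      by (auto simp: es_def length_chain_edges)
    obtain xs u v where vsl: "vs = xs @ [u, v]"
      by (metis vs append_butlast_last_id append.assoc append_Cons append_Nil list.distinct(1)
          butlast.simps(2))
    have ab: "{a, b} \<in> adj_edges G a" using walk(2) by (simp add: vs adj_edges_def)
    have uv: "{u, v} \<in> adj_edges G v"
      using walk(2) by (simp add: vsl adj_edges_def successively_append_iff)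
    \<comment> \<open>Each end lies on one chain edge only, the edge whose label its weights ignore.
      So the weights do not depend on any chain label.\<close>
    have a_only: "e = {a, b}" if "e \<in> set es" "a \<in> e" for e
      using that dist chain_edges_subset[of e "b # ys"] by (auto simp: es_def vs)
    have v_only: "e = {u, v}" if "e \<in> set es" "v \<in> e" for e
      using that dist chain_edges_subset[of e "xs @ [u]"]
      by (auto simp: es_def vsl chain_edges_snoc)
    have "vdegree G a \<in> {1, 2}" using deg(1) vs by simp
    with P obtain y :: "('v set \<Rightarrow> 'n) \<Rightarrow> 'n \<Rightarrow> ('n, 'a) mpoly" where
      y: "\<forall>l. adj_partial l G a P = (\<Sum>k\<in>UNIV. y l k * ?A $ k $ l {a, b})"
      and y': "\<forall>l l'. (\<forall>e'\<in>adj_edges G a - {{a, b}}. l e' = l' e') \<longrightarrow> y l = y l'"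
      by (rule chain_end_weights[OF _ _ _ ab])
    have "vdegree G v \<in> {1, 2}" using deg(2) vsl by simp
    with P obtain z :: "('v set \<Rightarrow> 'n) \<Rightarrow> 'n \<Rightarrow> ('n, 'a) mpoly" where
      z: "\<forall>l. adj_partial l G v P = (\<Sum>k\<in>UNIV. z l k * ?A $ k $ l {u, v})"
      and z': "\<forall>l l'. (\<forall>e'\<in>adj_edges G v - {{u, v}}. l e' = l' e') \<longrightarrow> z l = z l'"
      by (rule chain_end_weights[OF _ _ _ uv])
    \<comment> \<open>The weights at v put the free index in the row, while \<open>path_prod\<close>
      ends with it in the column.\<close>
    have sym: "?A $ i $ k = ?A $ k $ i" for i k by (simp add: Hess_def partial_commute)
    have chain_prod: "(\<Prod>x\<in>set vs. adj_partial l G x P) =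
        (\<Sum>i\<in>UNIV. y l i * (\<Sum>k\<in>UNIV. z l k * path_prod ?A i es k l))" for l
      unfolding es_def vs
    proof (rule prod_chain)
      show "distinct (a # b # ys)" using dist vs by simp
      show "adj_partial l G a P = (\<Sum>i\<in>UNIV. y l i * ?A $ i $ l {a, b})" using y by blast
    next
      fix xs' u' v' assume "a # b # ys = xs' @ [u', v']"
      then have "u' = u" "v' = v" using vsl vs by auto
      then show "adj_partial l G v' P = (\<Sum>k\<in>UNIV. z l k * ?A $ l {u', v'} $ k)"
        using z by (simp add: sym)
    next
      fix xs' u' v' w' zs' assume "a # b # ys = xs' @ u' # v' # w' # zs'"
      then have eq: "vs = xs' @ u' # v' # w' # zs'" using vs by simp
      have "vdegree G (vs ! Suc (length xs')) = 2" by (rule mid) (use len eq in auto)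
      then have card: "card (adj_edges G v') = 2" by (simp add: eq nth_append vdegree_def)
      have ne: "{u', v'} \<noteq> {v', w'}" using dist eq by (auto simp: doubleton_eq_iff)
      have sub: "{{u', v'}, {v', w'}} \<subseteq> adj_edges G v'"
        using walk(2) by (simp add: eq adj_edges_def successively_append_iff)
      \<comment> \<open>Degree 2 leaves no room at v' for an edge outside the chain.\<close>
      have "{{u', v'}, {v', w'}} = adj_edges G v'"
        by (rule card_subset_eq[OF finite_adj_edges[OF G] sub]) (use card ne in simp)
      then show "adj_partial l G v' P = ?A $ l {u', v'} $ l {v', w'}"
        using partials_pair[OF ne, of l P] by (simp add: adj_partial_eq)
    qed
    let ?R = "edges G - set es"
    have "graph_poly P G = (\<Sum>l\<in>set es \<union> ?R \<rightarrow>\<^sub>E UNIV. \<Prod>x\<in>verts G. adj_partial l G x P)"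
      using es(1) by (simp add: graph_poly_def Un_absorb1)
    also have "\<dots> = (\<Sum>l\<in>?R \<rightarrow>\<^sub>E UNIV. sum_labels es (\<lambda>l. \<Prod>x\<in>verts G. adj_partial l G x P) l)"
      by (rule sum_PiE_sum_labels[OF es(2)]) auto
    also have "\<dots> = 0"
    proof (rule sum.neutral, rule ballI)
      fix l :: "'v set \<Rightarrow> 'n"
      let ?c = "\<Prod>x\<in>verts G - set vs. adj_partial l G x P"
      \<comment> \<open>For the inner sum, the factors off the chain and both families of weights
        are constants, evaluated at l; only the path product varies with l'.\<close>
      have "sum_labels es (\<lambda>l. \<Prod>x\<in>verts G. adj_partial l G x P) l =
          sum_labels es (\<lambda>l'. ?c * (\<Sum>i\<in>UNIV. y l i * (\<Sum>k\<in>UNIV. z l k * path_prod ?A i es k l'))) l"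
      proof (rule sum_labels_cong)
        fix l' :: "'v set \<Rightarrow> 'n" assume l': "\<And>x. x \<notin> set es \<Longrightarrow> l' x = l x"
        have "y l' = y l" by (rule y'[rule_format], rule l') (use a_only in \<open>auto simp: adj_edges_def\<close>)
        moreover have "z l' = z l" by (rule z'[rule_format], rule l') (use v_only in \<open>auto simp: adj_edges_def\<close>)
        moreover have "adj_partial l' G x P = adj_partial l G x P" if "x \<notin> set vs" for x
          unfolding adj_partial_eq
        proof (rule partials_cong[OF finite_adj_edges[OF G]], rule l')
          fix e assume "e \<in> adj_edges G x"
          then show "e \<notin> set es"
            using that chain_edges_subset[of e vs] by (auto simp: es_def adj_edges_def)
        qed
        then have "(\<Prod>x\<in>verts G - set vs. adj_partial l' G x P) = ?c" by (intro prod.cong) auto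
        ultimately show "(\<Prod>x\<in>verts G. adj_partial l' G x P) =
            ?c * (\<Sum>i\<in>UNIV. y l i * (\<Sum>k\<in>UNIV. z l k * path_prod ?A i es k l'))"
          using prod.subset_diff[OF walk(1) fin, of "\<lambda>x. adj_partial l' G x P"] chain_prod[of l']
          by simp
      qed
      also have "\<dots> = ?c * (\<Sum>i\<in>UNIV. y l i * (\<Sum>k\<in>UNIV. z l k * matrix_pow ?A r $ i $ k))"
        by (simp only: sum_labels_mult sum_labels_sum sum_labels_path_prod[OF es(2)] es(3))
      finally show "sum_labels es (\<lambda>l. \<Prod>x\<in>verts G. adj_partial l G x P) l = 0"
        by (simp add: nil)
    qed
    finally show ?thesis .
  qed
qed

section \<open>Submodules and the quotient\<close>

text \<open>Each derivative lowers the degree of a surviving monomial by one; the additive form of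
  the bound avoids truncated subtraction.\<close>

lemma monom_degree_keys_partials:
  assumes "finite F" "\<forall>m\<in>Poly_Mapping.keys p. monom_degree m \<le> e"
    and "m \<in> Poly_Mapping.keys (partials l F p)"
  shows "monom_degree m + card F \<le> e"
  using assms(1,3)
proof (induction F arbitrary: m)
  case empty
  then show ?case using assms(2) by simp
next
  case (insert x F)
  then have "m + Poly_Mapping.single (l x) 1 \<in> Poly_Mapping.keys (partials l F p)"
    by (intro keys_partial) (simp add: partials_insert)
  from insert.IH[OF this] show ?case
    using insert.hyps by (simp add: monom_degree_add_single del: One_nat_def)
qed

lemma partials_eq_0:
  fixes p :: "('n::finite, 'a::comm_ring_1) mpoly"
  assumes "finite F" "total_degree p < card F"
  shows "partials l F p = 0"
proof -
  have "\<forall>m\<in>Poly_Mapping.keys p. monom_degree m \<le> total_degree p"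
    by (simp add: total_degree_def)
  from monom_degree_keys_partials[OF assms(1) this] assms(2)
  have "Poly_Mapping.keys (partials l F p) = {}" by fastforce
  then show ?thesis by simp
qed

lemma rho_tree_large_degree:
  assumes "total_degree P \<le> e" "v \<in> verts (rep_utree T)" "e + 1 \<le> vdegree (rep_utree T) v"
  shows "rho_tree P T = 0"
proof -
  note G = is_tree_rep_utree[of T]
  have "adj_partial l (rep_utree T) v P = 0" for l
    unfolding adj_partial_eq
    by (rule partials_eq_0[OF finite_adj_edges[OF G]]) (use assms in \<open>simp add: vdegree_def\<close>)
  then have "(\<Prod>v\<in>verts (rep_utree T). adj_partial l (rep_utree T) v P) = 0" for l
    using assms(2) is_treeD(1)[OF G] by (intro prod_zero) auto
  then show ?thesis by (simp add: rho_tree_eq graph_poly_def)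
qed

lemma rho_zero [simp]: "rho P 0 = 0"
  by (simp add: rho_def lin_ext_def)

lemma phi_zero [simp]: "phi P h 0 = 0"
proof -
  have "phi_tree P S 0 = 0" for S using phi_tree_add[of P S 0 0] by simp
  then show ?thesis by (simp add: phi_def lin_ext_zero_fun)
qed

lemma gl_submodule_rho_kernel: "gl_submodule {m. rho P m = 0}"
  by (auto simp: gl_submodule_def rat_vec.subspace_def rho_add rho_scale rho_gl_act)

lemma rho_CC:
  assumes "0 < r" "homogeneous d P" "2 \<le> d" "matrix_pow (Hess P) r = 0" "m \<in> CC r"
  shows "rho P m = 0"
proof -
  have "CC r \<subseteq> {m. rho P m = 0}"
    unfolding CC_def
  proof (rule hull_minimal)
    show "{basis T |T. \<exists>vs. naked_chain r (rep_utree T) vs} \<subseteq> {m. rho P m = 0}"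
      using graph_poly_naked_chain[OF is_tree_rep_utree _ assms(1-4)]
      by (auto simp: rho_def rho_tree_eq)
  qed (rule gl_submodule_rho_kernel)
  with assms(5) show ?thesis by auto
qed

lemma rho_VV:
  assumes "total_degree P \<le> e" "m \<in> VV e"
  shows "rho P m = 0"
proof -
  have "VV e \<subseteq> {m. rho P m = 0}"
    unfolding VV_def
  proof (rule rat_vec.span_minimal)
    show "{basis T |T. \<exists>v\<in>verts (rep_utree T). e + 1 \<le> vdegree (rep_utree T) v} \<subseteq> {m. rho P m = 0}"
      using rho_tree_large_degree[OF assms(1)] by (auto simp: rho_def)
    show "rat_vec.subspace {m. rho P m = 0}"
      using gl_submodule_rho_kernel by (auto simp: gl_submodule_def)
  qed
  with assms(2) show ?thesis by auto
qed

section \<open>Stability of the relations under the action\<close>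

lemma gl_act_add: "h \<odot> (m + m') = h \<odot> m + h \<odot> m'"
  by (simp add: gl_act_def lin_ext_add lin_ext_fun_add)

lemma gl_act_scale: "h \<odot> (c *\<^sub>Q m) = c *\<^sub>Q (h \<odot> m)"
  by (simp add: gl_act_def lin_ext_scale lin_ext_fun_scale)

lemma lin_ext_in_subspace:
  assumes "rat_vec.subspace N" "\<And>b. f b \<in> N"
  shows "lin_ext f m \<in> N"
  unfolding lin_ext_def
  by (intro rat_vec.subspace_sum[OF assms(1)] rat_vec.subspace_scale[OF assms(1)] assms(2))

lemma vdegree_iso:
  assumes "is_tree G" "is_iso f G H" "v \<in> verts G"
  shows "vdegree H (f v) = vdegree G v"
  unfolding vdegree_def adj_edges_iso(1)[OF assms]
  by (rule card_image[OF inj_on_subset[OF adj_edges_iso(2)[OF assms] adj_edges_subset]])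

lemma vdegree_graft_ge:
  assumes S: "is_rooted_tree S" and T: "is_tree T" and \<nu>: "\<nu> \<in> children S \<rightarrow> verts T"
  shows "vdegree T w \<le> vdegree (graft S \<nu> T) (Inr w)"
proof -
  have "vdegree T w = card ((`) Inr ` adj_edges T w :: ('a + 'b) set set)"
    unfolding vdegree_def
    by (rule card_image[symmetric], rule inj_on_subset[of _ UNIV]) (simp_all add: inj_image_eq_iff inj_def)
  also have "\<dots> \<le> vdegree (graft S \<nu> T) (Inr w)"
    unfolding vdegree_def adj_edges_graft_Inr[OF S]
    by (rule card_mono) (use finite_children[OF S] finite_adj_edges[OF T] in auto)
  finally show ?thesis .
qed

text \<open>Grafting only adds edges at the vertices of T, so v keeps its large degree. The
  isomorphism f carries v to the chosen representative of the class of the graft.\<close>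

lemma gl_tree_in_VV:
  assumes v: "v \<in> verts (rep_utree T)" "e + 1 \<le> vdegree (rep_utree T) v"
  shows "gl_tree S T \<in> VV e"
  unfolding gl_tree_def
proof (rule rat_vec.subspace_sum)
  show "rat_vec.subspace (VV e)" by (simp add: VV_def)
  fix \<nu> assume \<nu>: "\<nu> \<in> children (rep_rtree S) \<rightarrow>\<^sub>E verts (rep_utree T)"
  let ?G = "graft (rep_rtree S) \<nu> (rep_utree T)"
  have \<nu>': "\<nu> \<in> children (rep_rtree S) \<rightarrow> verts (rep_utree T)" using \<nu> by auto
  note S = is_rooted_tree_rep_rtree[of S] and T = is_tree_rep_utree[of T]
  have G: "is_tree ?G" by (rule is_tree_graft[OF S T \<nu>'])
  have "tree_iso ?G (rep_utree (utree_of ?G))"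
    using utree_of_eq_iff[OF G, of "utree_of ?G"] tree_iso_sym[OF is_tree_rep_utree] by blast
  then obtain f where f: "is_iso f ?G (rep_utree (utree_of ?G))" by (auto simp: tree_iso_def)
  have w: "Inr v \<in> verts ?G" using v(1) by (simp add: graft_def)
  have "f (Inr v) \<in> verts (rep_utree (utree_of ?G))"
    using f w by (auto simp: is_iso_def bij_betw_def)
  moreover have "e + 1 \<le> vdegree (rep_utree (utree_of ?G)) (f (Inr v))"
    using vdegree_iso[OF G f w] vdegree_graft_ge[OF S T \<nu>', of v] v(2) by linarith
  ultimately show "basis (utree_of ?G) \<in> VV e"
    unfolding VV_def by (intro rat_vec.span_base) blast
qed

lemma gl_submodule_VV: "gl_submodule (VV e)"
proof -
  have sub: "rat_vec.subspace (VV e)" by (simp add: VV_def)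
  have "h \<odot> m \<in> VV e" if "m \<in> VV e" for h m
    using that unfolding VV_def
  proof (induction rule: rat_vec.span_induct)
    \<comment> \<open>The vectors that h carries into \<open>VV e\<close> form a subspace; the
      instance of \<open>gl_act_scale\<close> with scalar 0 says that h sends 0 to 0.\<close>
    case base
    show ?case
      unfolding rat_vec.subspace_def using sub
      by (auto simp: VV_def[symmetric] gl_act_add gl_act_scale rat_vec.subspace_add
          rat_vec.subspace_scale rat_vec.subspace_0 gl_act_scale[of h 0 0, simplified])
  next
    case (step x)
    then obtain T v where x: "x = basis T"
      "v \<in> verts (rep_utree T)" "e + 1 \<le> vdegree (rep_utree T) v" by blast
    show ?case
      unfolding x(1) gl_act_def VV_def[symmetric]
      by (rule lin_ext_in_subspace[OF sub]) (simp add: gl_tree_in_VV[OF x(2,3)])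
  qed
  with sub show ?thesis by (simp add: gl_submodule_def)
qed

lemma gl_submodule_plus:
  assumes M: "gl_submodule M" and N: "gl_submodule N"
  shows "gl_submodule (M + N)"
proof -
  have "M + N = {x + y |x y. x \<in> M \<and> y \<in> N}" by (auto simp: set_plus_def)
  then have "rat_vec.subspace (M + N)"
    using rat_vec.subspace_sums[of M N] M N by (simp add: gl_submodule_def)
  moreover have "h \<odot> m \<in> M + N" if m: "m \<in> M + N" for h m
  proof -
    obtain x y where "m = x + y" "x \<in> M" "y \<in> N" using m by (rule set_plus_elim)
    with M N show ?thesis by (auto simp: gl_act_add gl_submodule_def intro!: set_plus_intro)
  qed
  ultimately show ?thesis by (simp add: gl_submodule_def)
qed

lemma gl_submodule_relations: "gl_submodule (relations r e)"
  by (cases e) (simp_all add: relations_def gl_submodule_CC gl_submodule_VV gl_submodule_plus)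

section \<open>Operations on cosets\<close>

lemma proj_eq_iff: "proj r e m = proj r e m' \<longleftrightarrow> m - m' \<in> relations r e"
proof -
  have R: "rat_vec.subspace (relations r e)"
    using gl_submodule_relations by (simp add: gl_submodule_def)
  show ?thesis
  proof
    assume "proj r e m = proj r e m'"
    moreover have "m \<in> proj r e m"
      using rat_vec.subspace_0[OF R] by (auto simp: proj_def elt_set_plus_def)
    ultimately show "m - m' \<in> relations r e" by (auto simp: proj_def elt_set_plus_def)
  next
    assume d: "m - m' \<in> relations r e"
    have "x \<in> proj r e m \<longleftrightarrow> x \<in> proj r e m'" for x
    proof -
      have "x \<in> proj r e k \<longleftrightarrow> x - k \<in> relations r e" for k
        by (auto simp: proj_def elt_set_plus_def intro: bexI[of _ "x - k"])
      moreover have "x - m' = (x - m) + (m - m')" "x - m = (x - m') - (m - m')" by simp_all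
      ultimately show ?thesis
        using rat_vec.subspace_add[OF R _ d] rat_vec.subspace_diff[OF R _ d] by metis
    qed
    then show "proj r e m = proj r e m'" by blast
  qed
qed

lemma proj_add: "proj r e m + proj r e m' = proj r e (m + m')"
proof -
  have R: "rat_vec.subspace (relations r e)"
    using gl_submodule_relations by (simp add: gl_submodule_def)
  have "relations r e + relations r e = relations r e"
    using rat_vec.subspace_add[OF R] rat_vec.subspace_0[OF R] by (force simp: set_plus_def)
  then show ?thesis by (simp add: proj_def set_plus_rearrange)
qed

text \<open>Common to scaling and the action, both defined as unions over all representatives. An
  additive L that preserves the relations gives the same coset for each representative, so the union
  collapses to that coset.\<close>

lemma UN_proj:
  assumes "\<And>x. x \<in> relations r e \<Longrightarrow> L x \<in> relations r e" "\<And>x y. L (x + y) = L x + L y"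
  shows "(\<Union>x\<in>proj r e m. proj r e (L x)) = proj r e (L m)"
proof -
  have R: "rat_vec.subspace (relations r e)"
    using gl_submodule_relations by (simp add: gl_submodule_def)
  have "proj r e (L x) = proj r e (L m)" if x: "x \<in> proj r e m" for x
  proof -
    obtain y where "y \<in> relations r e" "x = m + y"
      using x by (auto simp: proj_def elt_set_plus_def)
    then show ?thesis using assms by (simp add: proj_eq_iff)
  qed
  \<comment> \<open>A union of equal cosets is that coset only over a nonempty index set.\<close>
  moreover have "m \<in> proj r e m"
    using rat_vec.subspace_0[OF R] by (auto simp: proj_def elt_set_plus_def)
  ultimately show ?thesis by (intro SUP_eq_const) blast+
qed

lemma Mbar_act_proj: "Mbar_act r e h (proj r e m) = proj r e (h \<odot> m)"
  unfolding Mbar_act_def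
  by (rule UN_proj) (use gl_submodule_relations in \<open>auto simp: gl_submodule_def gl_act_add\<close>)

lemma Mbar_scale_proj: "Mbar_scale r e c (proj r e m) = proj r e (c *\<^sub>Q m)"
  unfolding Mbar_scale_def
  by (rule UN_proj)
     (use gl_submodule_relations in \<open>auto simp: gl_submodule_def scaleQ_add_right rat_vec.subspace_scale\<close>)

lemma rho_relations:
  assumes "0 < r" "homogeneous d P" "2 \<le> d" "matrix_pow (Hess P) r = 0"
    and "enat (total_degree P) \<le> e" "m \<in> relations r e"
  shows "rho P m = 0"
proof (cases e)
  case (enat k)
  then obtain x y where "m = x + y" "x \<in> CC r" "y \<in> VV k"
    using assms(6) by (auto simp: relations_def elim: set_plus_elim)
  then show ?thesis using rho_CC[OF assms(1-4)] rho_VV[of P k] assms(5) enat by (simp add: rho_add)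
next
  case infinity
  then show ?thesis using rho_CC[OF assms(1-4)] assms(6) by (simp add: relations_def)
qed

theorem proposition3p6:
  fixes P :: "('n::finite, 'a::comm_rat_algebra) mpoly"
    and r e :: nat
  assumes "r > 0" and "e > 0"
  shows "((\<exists>d\<ge>2. homogeneous d P) \<and> matrix_pow (Hess P) r = 0 \<longrightarrow> (\<forall>m\<in>CC r. rho P m = 0)) \<and>
    (total_degree P \<le> e \<longrightarrow> (\<forall>m\<in>VV e. rho P m = 0)) \<and>
    (\<forall>e'\<in>{enat e, \<infinity>}.
       (\<exists>d\<ge>2. homogeneous d P) \<and> enat (total_degree P) \<le> e' \<and> matrix_pow (Hess P) r = 0 \<longrightarrow>
       (\<forall>h. \<forall>A\<in>Mbar r e'. Mbar_act r e' h A \<in> Mbar r e') \<and>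
       (\<exists>rhobar :: MM set \<Rightarrow> ('n, 'a) mpoly.
          (\<forall>m. rhobar (proj r e' m) = rho P m) \<and>
          (\<forall>A\<in>Mbar r e'. \<forall>B\<in>Mbar r e'. rhobar (A + B) = rhobar A + rhobar B) \<and>
          (\<forall>c. \<forall>A\<in>Mbar r e'. rhobar (Mbar_scale r e' c A) = c *\<^sub>Q rhobar A) \<and>
          (\<forall>h. \<forall>A\<in>Mbar r e'. rhobar (Mbar_act r e' h A) = phi P h (rhobar A))))"
proof (intro conjI impI ballI)
  fix m assume "(\<exists>d\<ge>2. homogeneous d P) \<and> matrix_pow (Hess P) r = 0" "m \<in> CC r"
  then show "rho P m = 0" using rho_CC[OF assms(1)] by blast
next
  fix m assume "total_degree P \<le> e" "m \<in> VV e"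
  then show "rho P m = 0" by (rule rho_VV)
next
  fix e' assume "(\<exists>d\<ge>2. homogeneous d P) \<and> enat (total_degree P) \<le> e' \<and> matrix_pow (Hess P) r = 0"
  then obtain d where P: "homogeneous d P" "2 \<le> d" "matrix_pow (Hess P) r = 0"
    "enat (total_degree P) \<le> e'" by blast
  show "\<forall>h. \<forall>A\<in>Mbar r e'. Mbar_act r e' h A \<in> Mbar r e'"
    by (auto simp: Mbar_def Mbar_act_proj)
  \<comment> \<open>A representative is chosen for each coset. Two representatives differ by a
    relation, which \<open>rho_relations\<close> sends to 0, so the choice does not affect the
    value.\<close>
  define rhobar where "rhobar A = rho P (SOME m. A = proj r e' m)" for A
  have rhobar: "rhobar (proj r e' m) = rho P m" for m
  proof -
    have "proj r e' m = proj r e' (SOME k. proj r e' m = proj r e' k)" by (rule someI) simp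
    then have "rho P (m - (SOME k. proj r e' m = proj r e' k)) = 0"
      using rho_relations[OF assms(1) P] by (simp add: proj_eq_iff)
    then show ?thesis
      using rho_add[of P "m - (SOME k. proj r e' m = proj r e' k)" "SOME k. proj r e' m = proj r e' k"]
      by (simp add: rhobar_def)
  qed
  show "\<exists>rhobar :: MM set \<Rightarrow> ('n, 'a) mpoly.
          (\<forall>m. rhobar (proj r e' m) = rho P m) \<and>
          (\<forall>A\<in>Mbar r e'. \<forall>B\<in>Mbar r e'. rhobar (A + B) = rhobar A + rhobar B) \<and>
          (\<forall>c. \<forall>A\<in>Mbar r e'. rhobar (Mbar_scale r e' c A) = c *\<^sub>Q rhobar A) \<and>
          (\<forall>h. \<forall>A\<in>Mbar r e'. rhobar (Mbar_act r e' h A) = phi P h (rhobar A))"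
    by (rule exI[of _ rhobar])
       (auto simp: Mbar_def proj_add Mbar_act_proj Mbar_scale_proj rhobar rho_add rho_scale rho_gl_act)
qed

end
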